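(* Let $\Gamma$ be a graph with $n$ vertices, and let $m \in \{1,\dots,n\}$. Suppose that $\mu_m = d_m - m + 2 = 1$. Then $\Gamma$ is $K_m$ with $p$ pendant vertices attached to a vertex of $K_m$, for some integer $p \geqslant 0$.
   Context: All graphs are finite and simple. The Laplacian matrix of a graph $\Gamma$ is $L(\Gamma)=D-A$, where $A$ is the adjacency matrix and $D$ is the diagonal matrix of vertex degrees; its eigenvalues are the Laplacian eigenvalues of $\Gamma$. For $\Gamma$ with $n$ vertices, $d_i = d_i(\Gamma)$ and $\mu_i = \mu_i(\Gamma)$ denote respectively the $i$-th largest vertex degree and the $i$-th largest Laplacian eigenvalue of $\Gamma$, counted with multiplicity, so $d_1 \geqslant \dots \geqslant d_n$ and $\mu_1 \geqslant \dots \geqslant \mu_n = 0$. $K_m$ is the complete graph on $m$ vertices. Attaching $p$ pendant vertices to a vertex $v$ of a graph means adding $p$ new vertices, each joined by an edge to $v$ and to no other vertex. "$\Gamma$ is $G$" means $\Gamma$ is isomorphic to $G$.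
   Formalization: The conclusion is stated for Γ with its isolated vertices deleted (Γ itself if it has none), since the literal claim fails: a path on three vertices plus an isolated vertex has μ_2 = d_2 − 2 + 2 = 1 but is disconnected. *)

theory Defs
  imports "Graph_Theory.Graph_Theory" "Jordan_Normal_Form.Char_Poly"
begin

text \<open>
  A finite simple graph is a \<^locale>\<open>pair_graph\<close>: finite vertex set, symmetric and irreflexive
  set of arcs. Every undirected edge is a pair of opposite arcs, so the degree of a vertex is its
  \<^const>\<open>out_degree\<close>, and \<^const>\<open>digraph_iso\<close> is graph isomorphism.
\<close>

definition kth_largest :: "nat \<Rightarrow> 'a::linorder multiset \<Rightarrow> 'a" where
  "kth_largest k M = rev (sorted_list_of_multiset M) ! (k - 1)"

definition graph_degree :: "'a pair_pre_digraph \<Rightarrow> nat \<Rightarrow> nat" where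
  "graph_degree G i = kth_largest i (image_mset (out_degree G) (mset_set (pverts G)))"

text \<open>
  Matrices are indexed by natural numbers, so the vertices are numbered in an arbitrary way;
  another numbering conjugates the Laplacian matrix by a permutation matrix and leaves its
  characteristic polynomial unchanged.
\<close>

definition vertex_list :: "'a pair_pre_digraph \<Rightarrow> 'a list" where
  "vertex_list G = (SOME vs. distinct vs \<and> set vs = pverts G)"

definition adjacency_mat :: "'a pair_pre_digraph \<Rightarrow> real mat" where
  "adjacency_mat G = (let vs = vertex_list G; n = length vs in
     mat n n (\<lambda>(i, j). if (vs ! i, vs ! j) \<in> parcs G then 1 else 0))"

definition degree_mat :: "'a pair_pre_digraph \<Rightarrow> real mat" where
  "degree_mat G = (let vs = vertex_list G; n = length vs in
     mat n n (\<lambda>(i, j). if i = j then real (out_degree G (vs ! i)) else 0))"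

definition laplacian_mat :: "'a pair_pre_digraph \<Rightarrow> real mat" where
  "laplacian_mat G = degree_mat G - adjacency_mat G"

text \<open>
  The Laplacian matrix is real symmetric, so all roots of its characteristic polynomial are real
  and the multiset of its real roots lists all eigenvalues with their multiplicities.
\<close>

definition laplacian_eigenvalue :: "'a pair_pre_digraph \<Rightarrow> nat \<Rightarrow> real" where
  "laplacian_eigenvalue G i = kth_largest i (proots (char_poly (laplacian_mat G)))"

definition complete_graph :: "nat \<Rightarrow> nat pair_pre_digraph" where
  "complete_graph m = \<lparr> pverts = {..<m}, parcs = {(u, v). u < m \<and> v < m \<and> u \<noteq> v} \<rparr>"

definition attach_pendants :: "'a pair_pre_digraph \<Rightarrow> 'a \<Rightarrow> nat \<Rightarrow> ('a + nat) pair_pre_digraph" where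
  "attach_pendants G v p =
     \<lparr> pverts = Inl ` pverts G \<union> Inr ` {..<p},
       parcs = map_prod Inl Inl ` parcs G
         \<union> {Inl v} \<times> Inr ` {..<p} \<union> Inr ` {..<p} \<times> {Inl v} \<rparr>"

text \<open>
  Isolated vertices must be discarded before comparing with a complete graph with pendant vertices:
  they only contribute degrees 0 and eigenvalues 0 at the ends of the two sequences, and so are
  invisible to a hypothesis on the \<open>m\<close>-th degree and eigenvalue. For example, a path on three
  vertices together with an isolated vertex has degrees 2, 1, 1, 0 and Laplacian eigenvalues
  3, 1, 0, 0, hence satisfies the hypotheses for \<open>m = 2\<close> although it is not connected. For a graph
  without isolated vertices the operation is the identity (\<open>delete_isolated_eq\<close> below).
\<close>

definition isolated_vertices :: "'a pair_pre_digraph \<Rightarrow> 'a set" where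
  "isolated_vertices G = {v \<in> pverts G. out_degree G v = 0}"

definition delete_isolated :: "'a pair_pre_digraph \<Rightarrow> ('a, 'a \<times> 'a) pre_digraph" where
  "delete_isolated G = with_proj G \<restriction> (pverts G - isolated_vertices G)"

lemma complete_digraph_complete_graph: "complete_digraph m (with_proj (complete_graph m))"
proof -
  have "pair_graph (complete_graph m)"
  proof
    have "parcs (complete_graph m) \<subseteq> {..<m} \<times> {..<m}"
      by (auto simp: complete_graph_def)
    then show "finite (parcs (complete_graph m))"
      by (rule finite_subset) simp
  qed (auto simp: complete_graph_def symmetric_def sym_def)
  then interpret pair_graph "complete_graph m" .
  have "graph (with_proj (complete_graph m))" by unfold_locales
  then show ?thesis
    unfolding complete_digraph_def by (auto simp: complete_graph_def)
qed

lemma pair_graph_attach_pendants: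
  assumes "pair_graph G" "v \<in> pverts G"
  shows "pair_graph (attach_pendants G v p)"
proof -
  interpret pair_graph G by fact
  have "sym (parcs G)" using pair_sym_arcs by (simp add: symmetric_def)
  then show ?thesis
    using assms(2) pair_finite_verts pair_finite_arcs
    by unfold_locales
      (auto simp: attach_pendants_def symmetric_def sym_def dest: in_arcsD1 in_arcsD2 no_loops')
qed

lemma delete_isolated_eq:
  assumes "pair_graph G" "isolated_vertices G = {}"
  shows "delete_isolated G = with_proj G"
proof -
  interpret pair_graph G by fact
  show ?thesis
    using assms(2)
    by (auto simp: delete_isolated_def induce_subgraph_def with_proj_def
        dest: in_arcsD1 in_arcsD2)
qed

end

theory Submission
  imports Defs "Jordan_Normal_Form.Spectral_Radius"
begin

text \<open>
  Let \<open>S\<close> consist of \<open>m\<close> vertices of largest degree, so that the vertices in \<open>S\<close> have degree at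
  least \<open>m - 1\<close> and the others at most \<open>m - 1\<close>. The spectral hypothesis enters through the
  Courant-Fischer principle: since \<open>\<mu>\<^sub>m \<le> 1\<close>, every \<open>m\<close>-dimensional space of functions on the
  vertices contains a nonzero \<open>z\<close> whose Laplacian quadratic form, the sum of \<open>(z u - z v)\<^sup>2\<close> over
  the edges, is at most \<open>|z|\<^sup>2\<close>; and if the two are equal, \<open>z\<close> can be taken to be an eigenfunction
  for the eigenvalue 1 (\<open>laplacian_test_function\<close>, which rests on the spectral theorem for real
  symmetric matrices). All spaces used consist of the functions that are arbitrary on \<open>S\<close> and
  extended to the other vertices by a fixed linear rule. Because the quadratic form is a sum of
  squares, keeping only some well-chosen edges bounds it from below, and three choices of the
  extension determine the graph.

  Extension by 0 shows that some vertex of \<open>S\<close> has no neighbour outside \<open>S\<close>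
  (\<open>exists_inner_vertex\<close>); by the degree condition such an inner vertex is adjacent to all of
  \<open>S\<close>. Extension by minus the sum over the inner vertices, on one outer neighbour for each
  remaining vertex of \<open>S\<close>, shows that at most one vertex \<open>r\<close> of \<open>S\<close> has outer neighbours
  (\<open>at_most_one_boundary_vertex\<close>). Hence \<open>S\<close> is a clique. Extension by plus and minus the sum over
  \<open>S\<close> on the two ends of an edge disjoint from \<open>S\<close> shows that there is no such edge
  (\<open>no_arcs_outside_clique\<close>). So every vertex outside \<open>S\<close> is isolated or adjacent to \<open>r\<close> only.
\<close>

section \<open>The spectral theorem for real symmetric matrices\<close>

lemma symmetric_mat_self_adjoint:
  fixes A :: "'a :: comm_ring_1 mat"
  assumes A: "A \<in> carrier_mat n n" and sym: "A\<^sup>T = A"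
    and v: "v \<in> carrier_vec n" and w: "w \<in> carrier_vec n"
  shows "(A *\<^sub>v v) \<bullet> w = v \<bullet> (A *\<^sub>v w)"
  using transpose_vec_mult_scalar[OF A w v] sym A v w
  by metis

text \<open>
  A complex eigenvalue \<open>k\<close> of a real symmetric matrix with eigenvector \<open>v\<close> satisfies
  \<open>k * |v|\<^sup>2 = (C v, v) = (v, C v) = cnj k * |v|\<^sup>2\<close>, so it is real, and a real root of the
  characteristic polynomial has a real eigenvector.
\<close>

lemma real_symmetric_has_real_eigenvalue:
  fixes A :: "real mat"
  assumes A: "A \<in> carrier_mat n n" and n: "0 < n" and sym: "A\<^sup>T = A"
  shows "\<exists>e. eigenvalue A e"
proof -
  define C where "C = map_mat complex_of_real A"
  have C: "C \<in> carrier_mat n n" using A by (simp add: C_def)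
  have symC: "C\<^sup>T = C"
    using sym by (metis C_def map_mat_transpose)
  obtain k where "eigenvalue C k"
    using spectrum_non_empty[OF C n] by (auto simp: spectrum_def)
  then obtain v where v: "v \<in> carrier_vec n" "v \<noteq> 0\<^sub>v n" and Cv: "C *\<^sub>v v = k \<cdot>\<^sub>v v"
    using C by (auto simp: eigenvalue_def eigenvector_def)
  have conjC: "conjugate (C *\<^sub>v v) = C *\<^sub>v conjugate v"
    using C v(1) A
    by (intro eq_vecI) (auto simp: C_def scalar_prod_def sum_conjugate conjugate_dist_mul conjugate_complex_def)
  have "k * (v \<bullet>c v) = (C *\<^sub>v v) \<bullet>c v"
    using v by (simp add: Cv)
  also have "\<dots> = v \<bullet> (C *\<^sub>v conjugate v)"
    by (rule symmetric_mat_self_adjoint[OF C symC]) (use v in auto)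
  also have "\<dots> = v \<bullet>c (k \<cdot>\<^sub>v v)" by (simp add: conjC[symmetric] Cv)
  also have "\<dots> = cnj k * (v \<bullet>c v)"
    using v by (simp add: conjugate_smult_vec conjugate_complex_def)
  finally have "k = cnj k"
    using conjugate_square_eq_0_vec[OF v(1)] v(2) by simp
  then have k: "k = complex_of_real (Re k)"
    by (metis Reals_cnj_iff of_real_Re)
  have "poly (char_poly C) k = 0"
    using \<open>eigenvalue C k\<close> eigenvalue_root_char_poly[OF C] by simp
  then have "complex_of_real (poly (char_poly A) (Re k)) = 0"
    by (metis C_def k A of_real_hom.char_poly_hom of_real_hom.poly_map_poly)
  then show ?thesis
    using eigenvalue_root_char_poly[OF A] by auto
qed

text \<open>
  The orthogonal matrix is the Householder reflection that exchanges \<open>v\<close> with the first unit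
  vector. Being an involution, it is its own inverse and transpose, which keeps the change of
  basis in the spectral theorem short.
\<close>

lemma unit_vec_first_column_of_reflection:
  fixes v :: "real vec"
  assumes v: "v \<in> carrier_vec n" and unit: "v \<bullet> v = 1" and n: "0 < n"
  shows "\<exists>W \<in> carrier_mat n n. W\<^sup>T = W \<and> W * W = 1\<^sub>m n \<and> col W 0 = v"
proof (cases "v = unit_vec n 0")
  case True
  then show ?thesis using n by (intro bexI[of _ "1\<^sub>m n"]) auto
next
  case False
  define u where "u = v - unit_vec n 0"
  define q where "q = (\<Sum>k<n. u $ k * u $ k)"
  have u: "u \<in> carrier_vec n" using v by (simp add: u_def)
  have uu: "u \<bullet> u = q" using u by (simp add: scalar_prod_def q_def atLeast0LessThan)
  have "u \<noteq> 0\<^sub>v n"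
  proof
    assume "u = 0\<^sub>v n"
    then have "v $ i = unit_vec n 0 $ i" if "i < n" for i
    proof -
      have "u $ i = 0" using \<open>u = 0\<^sub>v n\<close> that by simp
      then show ?thesis using that v by (auto simp: u_def)
    qed
    then have "v = unit_vec n 0" using v by (intro eq_vecI) auto
    with False show False ..
  qed
  then have q0: "q \<noteq> 0"
    using conjugate_square_eq_0_vec[OF u] uu by simp
  have "q = v \<bullet> v - 2 * v $ 0 + 1"
    unfolding uu[symmetric] u_def using v n
    by (simp add: minus_scalar_prod_distrib[of _ n] scalar_prod_minus_distrib[of _ n])
  then have q: "q = - 2 * u $ 0" using v n unit by (simp add: u_def)
  define W where "W = mat n n (\<lambda>(i, j). (if i = j then 1 else 0) - 2 / q * (u $ i * u $ j))"
  have W: "W \<in> carrier_mat n n" by (simp add: W_def)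
  have "W\<^sup>T = W" by (rule eq_matI) (auto simp: W_def)
  moreover have "W * W = 1\<^sub>m n"
  proof (rule eq_matI)
    fix i j assume "i < dim_row (1\<^sub>m n)" "j < dim_col (1\<^sub>m n)"
    then have ij: "i < n" "j < n" by auto
    let ?d = "\<lambda>i j. if i = j then 1 else 0 :: real"
    have "(W * W) $$ (i, j) =
        (\<Sum>k<n. (?d i k - 2 / q * (u $ i * u $ k)) * (?d k j - 2 / q * (u $ k * u $ j)))"
      using ij by (simp add: W_def scalar_prod_def atLeast0LessThan)
    also have "\<dots> = (\<Sum>k<n. ?d i k * ?d k j - (2 / q * u $ i) * (u $ k * ?d k j)
        - (2 / q * u $ j) * (?d i k * u $ k) + (2 / q * (2 / q) * (u $ i * u $ j)) * (u $ k * u $ k))"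
      by (intro sum.cong refl) (simp only: algebra_simps)
    also have "\<dots> = ?d i j - (2 / q * u $ i) * u $ j - (2 / q * u $ j) * u $ i
        + (2 / q * (2 / q) * (u $ i * u $ j)) * q"
      using ij
      by (simp only: sum.distrib sum_subtractf sum_distrib_left[symmetric] q_def[symmetric])
        (simp add: if_distrib[of "\<lambda>x. _ * x"] if_distrib[of "\<lambda>x. x * _"] cong: if_cong)
    also have "\<dots> = 1\<^sub>m n $$ (i, j)" using ij q0 by (simp add: field_simps)
    finally show "(W * W) $$ (i, j) = 1\<^sub>m n $$ (i, j)" .
  qed (auto simp: W_def)
  moreover have "col W 0 = v"
  proof (rule eq_vecI)
    fix i assume "i < dim_vec v"
    then have i: "i < n" using v by simp
    have u0: "u $ 0 = - q / 2" using q by simp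
    have "col W 0 $ i = (if i = 0 then 1 else 0) + u $ i"
      using i n q0 by (simp add: W_def u0)
    also have "\<dots> = v $ i" using i n v by (simp add: u_def)
    finally show "col W 0 $ i = v $ i" .
  qed (use v W in auto)
  ultimately show ?thesis using W by blast
qed

text \<open>
  Spectral theorem, by induction on the dimension: conjugating by a reflection that moves the first
  unit vector to an eigenvector makes the first column, and by symmetry the first row, diagonal;
  the remaining block is symmetric again.
\<close>

theorem real_symmetric_orthogonally_diagonalizable:
  fixes A :: "real mat"
  assumes "A \<in> carrier_mat n n" and "A\<^sup>T = A"
  shows "\<exists>U \<in> carrier_mat n n. \<exists>e. U\<^sup>T * U = 1\<^sub>m n \<and> A * U = U * mat_diag n e"
  using assms
proof (induction n arbitrary: A)
  case 0
  then show ?case by (intro bexI[of _ "1\<^sub>m 0"] exI conjI eq_matI) (auto simp: mat_diag_def)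
next
  case (Suc n A)
  note A = Suc.prems(1) and sym = Suc.prems(2)
  obtain l w where w: "w \<in> carrier_vec (Suc n)" "w \<noteq> 0\<^sub>v (Suc n)" and Aw: "A *\<^sub>v w = l \<cdot>\<^sub>v w"
    using real_symmetric_has_real_eigenvalue[OF A _ sym] A
    by (auto simp: eigenvalue_def eigenvector_def)
  define v where "v = (1 / sqrt (w \<bullet> w)) \<cdot>\<^sub>v w"
  have ww: "w \<bullet> w > 0" using conjugate_square_greater_0_vec[OF w(1)] w(2) by simp
  have v: "v \<in> carrier_vec (Suc n)" and vv: "v \<bullet> v = 1" and Av: "A *\<^sub>v v = l \<cdot>\<^sub>v v"
    using w ww A Aw by (auto simp: v_def mult_mat_vec smult_smult_assoc mult.commute)
  obtain W where W: "W \<in> carrier_mat (Suc n) (Suc n)" "W\<^sup>T = W" "W * W = 1\<^sub>m (Suc n)" "col W 0 = v"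
    using unit_vec_first_column_of_reflection[OF v vv] by auto
  define B where "B = W * A * W"
  have B: "B \<in> carrier_mat (Suc n) (Suc n)" using W A by (simp add: B_def)
  have symB: "B\<^sup>T = B"
    unfolding B_def using W(1,2) A sym
    by (simp add: transpose_mult[of _ "Suc n" "Suc n" _ "Suc n"] assoc_mult_mat[of _ "Suc n" "Suc n" _ "Suc n" _ "Suc n"])
  have "B = W * (A * W)"
    unfolding B_def using W(1) A by (simp add: assoc_mult_mat[of _ "Suc n" "Suc n" _ "Suc n" _ "Suc n"])
  then have "col B 0 = W *\<^sub>v (A *\<^sub>v col W 0)"
    using col_mult2[OF W(1), of "A * W" "Suc n" 0] col_mult2[OF A W(1), of 0] A W(1) by simp
  also have "\<dots> = l \<cdot>\<^sub>v (W *\<^sub>v col W 0)"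
    using W v Av by (simp add: mult_mat_vec)
  also have "W *\<^sub>v col W 0 = col (W * W) 0" using col_mult2[OF W(1) W(1), of 0] by simp
  also have "\<dots> = unit_vec (Suc n) 0" using W(3) by simp
  finally have colB: "col B 0 = l \<cdot>\<^sub>v unit_vec (Suc n) 0" .
  have B_col: "B $$ (i, 0) = (if i = 0 then l else 0)" if "i < Suc n" for i
    using arg_cong[OF colB, of "\<lambda>x. x $ i"] that B by simp
  have B_row: "B $$ (0, i) = (if i = 0 then l else 0)" if "i < Suc n" for i
    using B_col[OF that] that B symB by (metis carrier_matD index_transpose_mat(1) zero_less_Suc)
  define D where "D = mat n n (\<lambda>(i, j). B $$ (Suc i, Suc j))"
  have D: "D \<in> carrier_mat n n" by (simp add: D_def)
  have "D\<^sup>T = D"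
  proof (rule eq_matI)
    fix i j assume "i < dim_row D" "j < dim_col D"
    then have ij: "i < n" "j < n" by (auto simp: D_def)
    then have "B $$ (Suc j, Suc i) = B\<^sup>T $$ (Suc i, Suc j)" using B by simp
    then show "D\<^sup>T $$ (i, j) = D $$ (i, j)" using ij by (simp add: D_def symB)
  qed (auto simp: D_def)
  from Suc.IH[OF D this] obtain U e where U: "U \<in> carrier_mat n n" "U\<^sup>T * U = 1\<^sub>m n"
    and DU: "D * U = U * mat_diag n e" by auto
  let ?z = "0\<^sub>m 1 n :: real mat" and ?z' = "0\<^sub>m n 1 :: real mat" and ?l = "mat_diag 1 (\<lambda>_. l)"
  have B_block: "B = four_block_mat ?l ?z ?z' D"
    using B by (intro eq_matI) (auto simp: D_def B_col B_row mat_diag_def)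
  define U' where "U' = four_block_mat (1\<^sub>m 1) ?z ?z' U"
  have U': "U' \<in> carrier_mat (Suc n) (Suc n)"
    using four_block_carrier_mat[of "1\<^sub>m 1" 1 1 U n n ?z ?z'] U by (simp add: U'_def)
  have orthU': "U'\<^sup>T * U' = 1\<^sub>m (Suc n)"
    unfolding U'_def using U
    by (subst transpose_four_block_mat[of _ 1 1 _ n _ n])
      (auto simp: mult_four_block_mat[of _ 1 1 _ n _ n _ _ 1 _ n] four_block_one_mat)
  define e' where "e' = (\<lambda>i. case i of 0 \<Rightarrow> l | Suc i \<Rightarrow> e i)"
  have diag: "mat_diag (Suc n) e' = four_block_mat ?l ?z ?z' (mat_diag n e)"
    by (rule eq_matI) (auto simp: mat_diag_def e'_def split: nat.splits)
  have BU': "B * U' = U' * mat_diag (Suc n) e'"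
    unfolding B_block U'_def diag using U D DU
    by (simp add: mult_four_block_mat[of _ 1 1 _ n _ n _ _ 1 _ n]
        right_mult_one_mat[of _ 1 1] left_mult_one_mat[of _ 1 1]
        right_add_zero_mat[of _ 1 1] left_mult_zero_mat[of _ n n]
        right_mult_zero_mat[of _ 1 1] left_mult_zero_mat[of _ 1 1] del: One_nat_def)
  have "(W * U')\<^sup>T * (W * U') = 1\<^sub>m (Suc n)"
  proof -
    have "(W * U')\<^sup>T * (W * U') = U'\<^sup>T * ((W * W) * U')"
      using W(1,2) U'
      by (simp add: transpose_mult[of _ "Suc n" "Suc n" _ "Suc n"] assoc_mult_mat[of _ "Suc n" "Suc n" _ "Suc n" _ "Suc n"] del: W(3))
    then show ?thesis using W(3) U' orthU' by simp
  qed
  moreover have "A * (W * U') = W * U' * mat_diag (Suc n) e'"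
  proof -
    have "W * B = (W * W) * (A * W)"
      unfolding B_def using W(1) A
      by (simp add: assoc_mult_mat[of _ "Suc n" "Suc n" _ "Suc n" _ "Suc n"])
    then have "A * W = W * B" using W A by simp
    moreover have "A * (W * U') = A * W * U'" using A W(1) U' by simp
    moreover have "W * B * U' = W * (B * U')" using W(1) B U' by (rule assoc_mult_mat)
    ultimately have "A * (W * U') = W * (B * U')" by simp
    then show ?thesis using W(1) U' BU' by (simp add: assoc_mult_mat[of _ "Suc n" "Suc n" _ "Suc n" _ "Suc n"])
  qed
  ultimately show ?case using W(1) U'
    by (intro bexI[of _ "W * U'"] exI[of _ e']) auto
qed

lemma proots_char_poly_orthogonal_diagonalization:
  fixes A :: "real mat"
  assumes A: "A \<in> carrier_mat n n" and U: "U \<in> carrier_mat n n" "U\<^sup>T * U = 1\<^sub>m n"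
    and AU: "A * U = U * mat_diag n e"
  shows "proots (char_poly A) = mset (map e [0..<n])"
proof -
  have UU: "U * U\<^sup>T = 1\<^sub>m n" using mat_mult_left_right_inverse[of "U\<^sup>T" n U] U by simp
  have "A = A * (U * U\<^sup>T)" using A UU by simp
  also have "\<dots> = U * mat_diag n e * U\<^sup>T"
    using A U AU by (metis assoc_mult_mat transpose_carrier_mat)
  finally have "similar_mat A (mat_diag n e)"
    using A U UU by (intro similar_matI[of _ _ U "U\<^sup>T" n]) auto
  then have "char_poly A = char_poly (mat_diag n e)" by (rule char_poly_similar)
  also have "\<dots> = (\<Prod>a \<leftarrow> diag_mat (mat_diag n e). [:- a, 1:])"
    by (intro char_poly_upper_triangular[of _ n]) (auto simp: mat_diag_def upper_triangular_def)
  also have "diag_mat (mat_diag n e) = map e [0..<n]"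
    by (auto simp: diag_mat_def mat_diag_def)
  finally have "char_poly A = (\<Prod>a \<leftarrow> map e [0..<n]. [:- a, 1:])" .
  moreover have "proots (\<Prod>a \<leftarrow> xs. [:- a, 1:]) = mset xs" for xs :: "real list"
  proof (induction xs)
    case (Cons x xs)
    have "(\<Prod>a \<leftarrow> xs. [:- a, 1:]) \<noteq> 0" by (auto simp: prod_list_zero_iff)
    then show ?case using Cons by (simp add: proots_mult del: mult_pCons_left)
  qed auto
  ultimately show ?thesis by (simp only:)
qed

section \<open>Linear conditions and the k-th largest eigenvalue\<close>

lemma kth_largest_bounds:
  fixes M :: "'a :: linorder multiset"
  assumes "1 \<le> k" and "k \<le> size M"
  shows "size (filter_mset (\<lambda>x. x > kth_largest k M) M) < k"
    and "k \<le> size (filter_mset (\<lambda>x. x \<ge> kth_largest k M) M)"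
    and "kth_largest k M \<in># M"
proof -
  define xs where "xs = rev (sorted_list_of_multiset M)"
  define x where "x = kth_largest k M"
  have len: "length xs = size M"
    unfolding xs_def by (metis length_rev mset_sorted_list_of_multiset size_mset)
  have M: "M = mset xs" by (simp add: xs_def)
  have x: "x = xs ! (k - 1)" by (simp add: x_def kth_largest_def xs_def)
  have desc: "xs ! j \<le> xs ! i" if "i \<le> j" "j < length xs" for i j
  proof -
    have "sorted (rev xs)" by (simp add: xs_def)
    then show ?thesis using that sorted_rev_nth_mono by blast
  qed
  have "{i. i < length xs \<and> xs ! i > x} \<subseteq> {..<k - 1}"
  proof
    fix i assume i: "i \<in> {i. i < length xs \<and> xs ! i > x}"
    show "i \<in> {..<k - 1}"
    proof (rule ccontr)
      assume "i \<notin> {..<k - 1}"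
      then have "xs ! i \<le> x" unfolding x using i by (intro desc) auto
      then show False using i by auto
    qed
  qed
  then have "card {i. i < length xs \<and> xs ! i > x} \<le> card {..<k - 1}"
    by (intro card_mono) auto
  then show "size (filter_mset (\<lambda>x. x > kth_largest k M) M) < k"
    using assms(1) by (simp add: M mset_filter[symmetric] length_filter_conv_card x_def[unfolded M] del: mset_filter)
  have "{..<k} \<subseteq> {i. i < length xs \<and> xs ! i \<ge> x}"
    using assms len by (auto simp: x intro!: desc)
  then have "card {..<k} \<le> card {i. i < length xs \<and> xs ! i \<ge> x}"
    by (intro card_mono) auto
  then show "k \<le> size (filter_mset (\<lambda>x. x \<ge> kth_largest k M) M)"
    by (simp add: M mset_filter[symmetric] length_filter_conv_card x_def[unfolded M] del: mset_filter)
  have "xs ! (k - 1) \<in> set xs" using assms len by (intro nth_mem) auto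
  then show "kth_largest k M \<in># M"
    using x x_def M by (metis set_mset_mset)
qed

text \<open>
  Padding the vectors with zero rows gives a singular square matrix.
\<close>

lemma nonzero_vec_orthogonal_to_few:
  fixes rs :: "'a :: field vec list"
  assumes rs: "set rs \<subseteq> carrier_vec n" and len: "length rs < n"
  shows "\<exists>z \<in> carrier_vec n. z \<noteq> 0\<^sub>v n \<and> (\<forall>r \<in> set rs. r \<bullet> z = 0)"
proof -
  define M where "M = mat n n (\<lambda>(i, j). if i < length rs then rs ! i $ j else 0)"
  have M: "M \<in> carrier_mat n n" by (simp add: M_def)
  have row_M: "row M i = rs ! i" if "i < length rs" for i
  proof -
    have "rs ! i \<in> carrier_vec n" using that rs nth_mem by blast
    then show ?thesis using that len by (intro eq_vecI) (auto simp: M_def)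
  qed
  have "M = mat\<^sub>r n n (\<lambda>i. if i = length rs then 0\<^sub>v n else row M i)"
    by (intro eq_matI) (auto simp: M_def)
  moreover have "det (mat\<^sub>r n n (\<lambda>i. if i = length rs then 0\<^sub>v n else row M i)) = 0"
    using len M by (intro det_row_0) auto
  ultimately have "det M = 0" by simp
  then obtain z where z: "z \<in> carrier_vec n" "z \<noteq> 0\<^sub>v n" and Mz: "M *\<^sub>v z = 0\<^sub>v n"
    using det_0_iff_vec_prod_zero[OF M] by blast
  have "rs ! i \<bullet> z = 0" if "i < length rs" for i
    using that len M row_M[OF that] arg_cong[OF Mz, of "\<lambda>x. x $ i"] by simp
  then have "\<forall>r \<in> set rs. r \<bullet> z = 0" by (metis in_set_conv_nth)
  then show ?thesis using z by blast
qed

text \<open>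
  One half of the Courant-Fischer principle, with its equality case. If the \<open>k\<close>-th largest
  eigenvalue is at most \<open>c\<close>, fewer than \<open>k\<close> eigenvalues exceed \<open>c\<close>. At most \<open>n - k\<close> linear
  conditions together with orthogonality to the eigenvectors of these eigenvalues are fewer than
  \<open>n\<close> conditions, so a nonzero vector meets all of them. It is a combination of eigenvectors for
  eigenvalues at most \<open>c\<close>, so its Rayleigh quotient is at most \<open>c\<close>, with equality only if
  all these eigenvalues are equal to \<open>c\<close>.
\<close>

theorem symmetric_form_small_on_codimension:
  fixes A :: "real mat"
  assumes A: "A \<in> carrier_mat n n" and sym: "A\<^sup>T = A"
    and k: "1 \<le> k" "k \<le> n" and small: "kth_largest k (proots (char_poly A)) \<le> c"
    and rs: "set rs \<subseteq> carrier_vec n" "length rs + k \<le> n"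
  shows "\<exists>z \<in> carrier_vec n. z \<noteq> 0\<^sub>v n \<and> (\<forall>r \<in> set rs. r \<bullet> z = 0) \<and>
    (A *\<^sub>v z) \<bullet> z \<le> c * (z \<bullet> z) \<and> ((A *\<^sub>v z) \<bullet> z = c * (z \<bullet> z) \<longrightarrow> A *\<^sub>v z = c \<cdot>\<^sub>v z)"
proof -
  obtain U e where U: "U \<in> carrier_mat n n" "U\<^sup>T * U = 1\<^sub>m n" and AU: "A * U = U * mat_diag n e"
    using real_symmetric_orthogonally_diagonalizable[OF A sym] by blast
  have UU: "U * U\<^sup>T = 1\<^sub>m n" using mat_mult_left_right_inverse[of "U\<^sup>T" n U] U by simp
  let ?es = "map e [0..<n]"
  define J where "J = filter (\<lambda>i. e i > c) [0..<n]"
  have "length J = size (filter_mset (\<lambda>x. x > c) (mset ?es))"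
    unfolding mset_filter[symmetric] size_mset by (simp add: J_def filter_map o_def)
  also have "\<dots> \<le> size (filter_mset (\<lambda>x. x > kth_largest k (mset ?es)) (mset ?es))"
  proof -
    have "kth_largest k (mset ?es) \<le> c"
      using small proots_char_poly_orthogonal_diagonalization[OF A U AU] by simp
    then have "filter_mset (\<lambda>x. x > c) (mset ?es) =
        filter_mset (\<lambda>x. x > c) (filter_mset (\<lambda>x. x > kth_largest k (mset ?es)) (mset ?es))"
      unfolding filter_filter_mset by (intro filter_mset_cong) auto
    then show ?thesis by (metis size_filter_mset_lesseq)
  qed
  also have "\<dots> < k" using k by (intro kth_largest_bounds(1)) auto
  finally have "length (rs @ map (col U) J) < n" using rs(2) by simp
  moreover have "set (rs @ map (col U) J) \<subseteq> carrier_vec n"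
    using rs(1) U by (auto simp: J_def)
  ultimately obtain z where z: "z \<in> carrier_vec n" "z \<noteq> 0\<^sub>v n"
    and orth: "\<forall>r \<in> set (rs @ map (col U) J). r \<bullet> z = 0"
    using nonzero_vec_orthogonal_to_few by blast
  define w where "w = U\<^sup>T *\<^sub>v z"
  have w: "w \<in> carrier_vec n" using U z by (simp add: w_def)
  have zw: "z = U *\<^sub>v w"
    unfolding w_def using U z UU by (metis assoc_mult_mat_vec one_mult_mat_vec transpose_carrier_mat)
  have w0: "w $ i = 0" if "i < n" "e i > c" for i
    using that U z orth by (auto simp: w_def J_def)
  let ?d = "mat_diag n e *\<^sub>v w"
  have Az: "A *\<^sub>v z = U *\<^sub>v ?d"
    unfolding zw using A U w AU by (metis assoc_mult_mat_vec mat_diag_dim)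
  have d: "?d $ i = e i * w $ i" if "i < n" for i
  proof -
    have "?d $ i = (\<Sum>j<n. (if i = j then e j else 0) * w $ j)"
      using that w by (simp add: mat_diag_def scalar_prod_def atLeast0LessThan)
    also have "\<dots> = (\<Sum>j<n. if i = j then e j * w $ j else 0)"
      by (intro sum.cong) auto
    also have "\<dots> = e i * w $ i" using that by simp
    finally show ?thesis .
  qed
  have iso: "(U *\<^sub>v x) \<bullet> (U *\<^sub>v y) = x \<bullet> y" if "x \<in> carrier_vec n" "y \<in> carrier_vec n" for x y
  proof -
    have "(U *\<^sub>v x) \<bullet> (U *\<^sub>v y) = x \<bullet> (U\<^sup>T *\<^sub>v (U *\<^sub>v y))"
      using transpose_vec_mult_scalar[OF U(1) that(1), of "U *\<^sub>v y"] U that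
      by (metis comm_scalar_prod mult_mat_vec_carrier transpose_carrier_mat)
    then show ?thesis using U that by (metis assoc_mult_mat_vec one_mult_mat_vec transpose_carrier_mat)
  qed
  have dc: "?d \<in> carrier_vec n" by (rule mult_mat_vec_carrier[OF mat_diag_dim w])
  have diff: "c * (z \<bullet> z) - (A *\<^sub>v z) \<bullet> z = (\<Sum>i<n. (c - e i) * (w $ i * w $ i))"
  proof -
    have "c * (z \<bullet> z) - (A *\<^sub>v z) \<bullet> z = c * (w \<bullet> w) - ?d \<bullet> w"
      by (simp add: Az) (simp add: zw iso w dc)
    also have "\<dots> = (\<Sum>i<n. (c - e i) * (w $ i * w $ i))"
      using w by (simp add: scalar_prod_def atLeast0LessThan d sum_distrib_left sum_subtractf[symmetric] algebra_simps del: index_mult_mat_vec)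
    finally show ?thesis .
  qed
  have term_nonneg: "(c - e i) * (w $ i * w $ i) \<ge> 0" if "i < n" for i
    using w0[OF that] by (cases "e i > c") auto
  have "(A *\<^sub>v z) \<bullet> z \<le> c * (z \<bullet> z)"
    using diff sum_nonneg[of "{..<n}" "\<lambda>i. (c - e i) * (w $ i * w $ i)"] term_nonneg by auto
  moreover have "A *\<^sub>v z = c \<cdot>\<^sub>v z" if "(A *\<^sub>v z) \<bullet> z = c * (z \<bullet> z)"
  proof -
    have "(c - e i) * (w $ i * w $ i) = 0" if i: "i < n" for i
      using diff that \<open>(A *\<^sub>v z) \<bullet> z = c * (z \<bullet> z)\<close> term_nonneg
        sum_nonneg_eq_0_iff[of "{..<n}" "\<lambda>i. (c - e i) * (w $ i * w $ i)"] by auto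
    then have "?d $ i = c * w $ i" if "i < n" for i
      using that d by fastforce
    then have "?d = c \<cdot>\<^sub>v w" using w dc
      by (intro eq_vecI) (auto simp: carrier_matD(1)[OF mat_diag_dim])
    then show ?thesis using U w by (simp add: Az) (simp add: zw mult_mat_vec)
  qed
  ultimately show ?thesis using z orth by (intro bexI[of _ z]) auto
qed

section \<open>The Laplacian as an operator on functions\<close>

definition nbrs :: "'a pair_pre_digraph \<Rightarrow> 'a \<Rightarrow> 'a set" where
  "nbrs G v = {u. (v, u) \<in> parcs G}"

text \<open>
  Both arcs of an edge contribute, so this is twice the quadratic form of the Laplacian matrix.
\<close>

definition dirichlet_energy :: "'a pair_pre_digraph \<Rightarrow> ('a \<Rightarrow> real) \<Rightarrow> real" where
  "dirichlet_energy G z = (\<Sum>(u, v) \<in> parcs G. (z u - z v)\<^sup>2)"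

definition laplacian :: "'a pair_pre_digraph \<Rightarrow> ('a \<Rightarrow> real) \<Rightarrow> 'a \<Rightarrow> real" where
  "laplacian G z v = (\<Sum>u \<in> nbrs G v. z v - z u)"

lemma out_degree_eq_card_nbrs: "out_degree (with_proj G) v = card (nbrs G v)"
proof -
  have "out_arcs (with_proj G) v = Pair v ` nbrs G v" by (auto simp: out_arcs_def nbrs_def)
  then show ?thesis by (simp add: out_degree_def card_image inj_on_def)
qed

context pair_graph
begin

lemma nbrs_subset: "nbrs G v \<subseteq> pverts G"
  by (auto simp: nbrs_def dest: in_arcsD2)

lemma finite_nbrs: "finite (nbrs G v)"
  by (rule finite_subset[OF nbrs_subset pair_finite_verts])

lemma arc_swap: "(u, v) \<in> parcs G \<longleftrightarrow> (v, u) \<in> parcs G"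
  using pair_sym_arcs by (auto simp: symmetric_def sym_def)

lemma not_nbr_self: "v \<notin> nbrs G v"
  by (auto simp: nbrs_def dest: no_loops')

lemma laplacian_eq: "laplacian G z v = real (card (nbrs G v)) * z v - (\<Sum>u \<in> nbrs G v. z u)"
  by (simp add: laplacian_def sum_subtractf)

lemma dirichlet_energy_eq: "dirichlet_energy G z = 2 * (\<Sum>v \<in> pverts G. z v * laplacian G z v)"
proof -
  have arcs: "parcs G = (SIGMA v : pverts G. nbrs G v)"
    by (auto simp: nbrs_def dest: in_arcsD1)
  have swap: "(\<Sum>(u, v) \<in> parcs G. z v * (z v - z u)) = (\<Sum>(u, v) \<in> parcs G. z u * (z u - z v))"
    by (rule sum.reindex_bij_witness[of _ prod.swap prod.swap]) (auto simp: arc_swap)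
  have "dirichlet_energy G z =
      (\<Sum>(u, v) \<in> parcs G. z u * (z u - z v)) + (\<Sum>(u, v) \<in> parcs G. z v * (z v - z u))"
    unfolding dirichlet_energy_def sum.distrib[symmetric]
    by (intro sum.cong) (auto simp: power2_eq_square algebra_simps)
  also have "\<dots> = 2 * (\<Sum>(u, v) \<in> parcs G. z u * (z u - z v))"
    by (simp add: swap)
  also have "(\<Sum>(u, v) \<in> parcs G. z u * (z u - z v)) = (\<Sum>v \<in> pverts G. z v * laplacian G z v)"
    unfolding arcs laplacian_def sum_distrib_left
    by (subst sum.Sigma) (auto simp: pair_finite_verts finite_nbrs)
  finally show ?thesis .
qed

lemma vertex_list: "distinct (vertex_list G)" "set (vertex_list G) = pverts G"
  and length_vertex_list: "length (vertex_list G) = card (pverts G)"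
proof -
  have "\<exists>vs. distinct vs \<and> set vs = pverts G"
    using finite_distinct_list[OF pair_finite_verts] by blast
  then have "distinct (vertex_list G) \<and> set (vertex_list G) = pverts G"
    unfolding vertex_list_def by (rule someI_ex)
  then show "distinct (vertex_list G)" "set (vertex_list G) = pverts G"
    and "length (vertex_list G) = card (pverts G)"
    by (auto simp: distinct_card[symmetric])
qed

lemma sum_vertex_list: "(\<Sum>i<card (pverts G). f (vertex_list G ! i)) = (\<Sum>v \<in> pverts G. f v)"
  by (rule sum.reindex_bij_betw, rule bij_betw_nth)
    (auto simp: vertex_list length_vertex_list)

lemma laplacian_mat_carrier: "laplacian_mat G \<in> carrier_mat (card (pverts G)) (card (pverts G))"
  unfolding carrier_mat_def
  by (simp add: laplacian_mat_def degree_mat_def adjacency_mat_def Let_def length_vertex_list)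

lemma laplacian_mat_symmetric: "(laplacian_mat G)\<^sup>T = laplacian_mat G"
  by (rule eq_matI)
    (auto simp: laplacian_mat_def degree_mat_def adjacency_mat_def Let_def arc_swap)

lemma laplacian_mat_index:
  assumes "i < card (pverts G)" and "j < card (pverts G)"
  shows "laplacian_mat G $$ (i, j) =
    (if i = j then real (card (nbrs G (vertex_list G ! i))) else 0)
      - (if vertex_list G ! j \<in> nbrs G (vertex_list G ! i) then 1 else 0)"
  using assms
  by (simp add: laplacian_mat_def degree_mat_def adjacency_mat_def Let_def length_vertex_list
      out_degree_eq_card_nbrs) (simp add: nbrs_def)

lemma laplacian_mat_mult_vec:
  assumes z: "\<And>i. i < card (pverts G) \<Longrightarrow> x $ i = z (vertex_list G ! i)"
    and x: "x \<in> carrier_vec (card (pverts G))" and i: "i < card (pverts G)"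
  shows "(laplacian_mat G *\<^sub>v x) $ i = laplacian G z (vertex_list G ! i)"
proof -
  let ?n = "card (pverts G)" and ?v = "\<lambda>i. vertex_list G ! i"
  have inV: "?v i \<in> pverts G" using i by (metis length_vertex_list nth_mem vertex_list(2))
  have "(laplacian_mat G *\<^sub>v x) $ i = (\<Sum>j<?n.
      (if ?v j = ?v i then real (card (nbrs G (?v i))) * z (?v i) else 0)
      - (if ?v j \<in> nbrs G (?v i) then z (?v j) else 0))"
  proof -
    have "?v j = ?v i \<longleftrightarrow> i = j" if "j < ?n" for j
      using that i vertex_list(1) by (auto simp: nth_eq_iff_index_eq length_vertex_list)
    then show ?thesis
      using i x laplacian_mat_carrier
      by (auto simp: scalar_prod_def atLeast0LessThan laplacian_mat_index z algebra_simps
          intro!: sum.cong)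
  qed
  also have "\<dots> = (\<Sum>v \<in> pverts G. (if v = ?v i then real (card (nbrs G (?v i))) * z (?v i) else 0)
      - (if v \<in> nbrs G (?v i) then z v else 0))"
    by (rule sum_vertex_list)
  also have "\<dots> = laplacian G z (?v i)"
    using inV pair_finite_verts nbrs_subset[of "?v i"]
    by (simp add: sum_subtractf laplacian_eq sum.inter_restrict[symmetric] Int_absorb1)
  finally show ?thesis .
qed

lemma laplacian_eigenvalue_in_proots:
  assumes "1 \<le> m" "m \<le> card (pverts G)"
  shows "laplacian_eigenvalue G m \<in># proots (char_poly (laplacian_mat G))"
proof -
  obtain U e where "U \<in> carrier_mat (card (pverts G)) (card (pverts G))"
    "U\<^sup>T * U = 1\<^sub>m (card (pverts G))" "laplacian_mat G * U = U * mat_diag (card (pverts G)) e"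
    using real_symmetric_orthogonally_diagonalizable[OF laplacian_mat_carrier laplacian_mat_symmetric]
    by blast
  from proots_char_poly_orthogonal_diagonalization[OF laplacian_mat_carrier this]
  have "size (proots (char_poly (laplacian_mat G))) = card (pverts G)"
    by (metis diff_zero length_map length_upt size_mset)
  then show ?thesis
    unfolding laplacian_eigenvalue_def using assms by (intro kth_largest_bounds(3)) auto
qed

lemma laplacian_eigenvalue_arcless:
  assumes "parcs G = {}" and m: "1 \<le> m" "m \<le> card (pverts G)"
  shows "laplacian_eigenvalue G m = 0"
proof -
  let ?n = "card (pverts G)"
  have L: "laplacian_mat G = 0\<^sub>m ?n ?n"
    using assms(1)
    by (intro eq_matI) (auto simp: laplacian_mat_def degree_mat_def adjacency_mat_def Let_def
        length_vertex_list out_degree_eq_card_nbrs nbrs_def)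
  have "char_poly (laplacian_mat G) \<noteq> 0"
    using laplacian_eigenvalue_in_proots[OF m] by auto
  then have "eigenvalue (laplacian_mat G) (laplacian_eigenvalue G m)"
    using laplacian_eigenvalue_in_proots[OF m] eigenvalue_root_char_poly[OF laplacian_mat_carrier]
    by simp
  then obtain x where x: "x \<in> carrier_vec ?n" "x \<noteq> 0\<^sub>v ?n"
    and "0\<^sub>m ?n ?n *\<^sub>v x = laplacian_eigenvalue G m \<cdot>\<^sub>v x"
    unfolding eigenvalue_def eigenvector_def by (auto simp: L)
  moreover have "0\<^sub>m ?n ?n *\<^sub>v x = 0\<^sub>v ?n" using x(1) by (intro eq_vecI) auto
  ultimately have eq: "laplacian_eigenvalue G m \<cdot>\<^sub>v x = 0\<^sub>v ?n" by simp
  obtain i where "i < ?n" "x $ i \<noteq> 0" using x by (metis eq_vecI carrier_vecD index_zero_vec)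
  with arg_cong[OF eq, of "\<lambda>y. y $ i"] x(1) show ?thesis by simp
qed

text \<open>
  The form in which the eigenvalue hypothesis is used. The functions whose values outside \<open>S\<close> are
  prescribed linear combinations (with coefficients \<open>a\<close>) of their values on \<open>S\<close> form a space of
  dimension \<open>card S\<close>, cut out by one equation for each vertex outside \<open>S\<close>. On every such space
  some nonzero function has Rayleigh quotient at most \<open>c\<close>; choosing \<open>a\<close> well turns this into
  information on the graph.
\<close>

theorem laplacian_test_function:
  assumes S: "S \<subseteq> pverts G" "S \<noteq> {}"
    and small: "laplacian_eigenvalue G (card S) \<le> c"
  obtains s z where "s \<in> S" "z s \<noteq> 0"
    and "\<And>v. v \<in> pverts G - S \<Longrightarrow> z v = (\<Sum>s \<in> S. a v s * z s)"
    and "dirichlet_energy G z \<le> 2 * c * (\<Sum>v \<in> pverts G. (z v)\<^sup>2)"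
    and "dirichlet_energy G z = 2 * c * (\<Sum>v \<in> pverts G. (z v)\<^sup>2) \<Longrightarrow>
      \<forall>v \<in> pverts G. laplacian G z v = c * z v"
proof -
  let ?n = "card (pverts G)" and ?v = "\<lambda>i. vertex_list G ! i"
  have finS: "finite S" using S(1) pair_finite_verts by (rule finite_subset)
  have k: "1 \<le> card S" "card S \<le> ?n"
    using S finS card_mono[OF pair_finite_verts S(1)] by (auto simp: Suc_le_eq card_gt_0_iff)
  \<comment> \<open>The equation expressing the value at a vertex \<open>v\<close> outside \<open>S\<close> by those on \<open>S\<close>.\<close>
  define r where "r v = vec ?n (\<lambda>i. (if ?v i = v then 1 else 0) - (if ?v i \<in> S then a v (?v i) else 0))" for v
  obtain os where os: "distinct os" "set os = pverts G - S"
    using finite_distinct_list pair_finite_verts by (metis finite_Diff)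
  have "length os = ?n - card S"
    using os S(1) finS by (metis card_Diff_subset distinct_card)
  then have len: "length (map r os) + card S \<le> ?n" using k by simp
  have rc: "set (map r os) \<subseteq> carrier_vec ?n" by (auto simp: r_def)
  obtain x where x: "x \<in> carrier_vec ?n" "x \<noteq> 0\<^sub>v ?n" and orth: "\<forall>v \<in> pverts G - S. r v \<bullet> x = 0"
    and le: "(laplacian_mat G *\<^sub>v x) \<bullet> x \<le> c * (x \<bullet> x)"
    and eq: "(laplacian_mat G *\<^sub>v x) \<bullet> x = c * (x \<bullet> x) \<longrightarrow> laplacian_mat G *\<^sub>v x = c \<cdot>\<^sub>v x"
    using symmetric_form_small_on_codimension[OF laplacian_mat_carrier laplacian_mat_symmetric k
        small[unfolded laplacian_eigenvalue_def] rc len] os(2) by auto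
  define z where "z v = x $ the_inv_into {..<?n} ?v v" for v
  have inj: "inj_on ?v {..<?n}"
    using vertex_list(1) by (simp add: inj_on_nth length_vertex_list)
  have xz: "x $ i = z (?v i)" if "i < ?n" for i
    using that by (simp add: z_def the_inv_into_f_f[OF inj])
  have z_out: "z v = (\<Sum>s \<in> S. a v s * z s)" if v: "v \<in> pverts G - S" for v
  proof -
    have "r v \<bullet> x = (\<Sum>i<?n. (if ?v i = v then z (?v i) else 0) - (if ?v i \<in> S then a v (?v i) * z (?v i) else 0))"
      using x by (auto simp: scalar_prod_def r_def atLeast0LessThan xz algebra_simps intro!: sum.cong)
    also have "\<dots> = (\<Sum>u \<in> pverts G. (if u = v then z u else 0) - (if u \<in> S then a v u * z u else 0))"
      by (rule sum_vertex_list)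
    also have "\<dots> = z v - (\<Sum>s \<in> S. a v s * z s)"
      using v S(1) pair_finite_verts
      by (simp add: sum_subtractf sum.inter_restrict[symmetric] Int_absorb1)
    finally show ?thesis using orth v by simp
  qed
  have "\<exists>s \<in> S. z s \<noteq> 0"
  proof (rule ccontr)
    assume "\<not> ?thesis"
    then have "z v = 0" if "v \<in> pverts G" for v
      using that z_out[of v] by (cases "v \<in> S") auto
    then have "x = 0\<^sub>v ?n"
      using x(1) xz vertex_list(2) length_vertex_list
      by (intro eq_vecI) (auto, metis nth_mem)
    with x(2) show False ..
  qed
  then obtain s where s: "s \<in> S" "z s \<noteq> 0" by blast
  have norm: "x \<bullet> x = (\<Sum>v \<in> pverts G. (z v)\<^sup>2)"
    using x(1) sum_vertex_list[of "\<lambda>v. (z v)\<^sup>2"]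
    by (simp add: scalar_prod_def xz atLeast0LessThan power2_eq_square)
  have energy: "2 * ((laplacian_mat G *\<^sub>v x) \<bullet> x) = dirichlet_energy G z"
    using x(1) sum_vertex_list[of "\<lambda>v. z v * laplacian G z v"] laplacian_mat_mult_vec[OF xz x(1)]
    by (simp add: scalar_prod_def xz atLeast0LessThan dirichlet_energy_eq mult.commute
        del: index_mult_mat_vec)
  have "\<forall>v \<in> pverts G. laplacian G z v = c * z v"
    if "dirichlet_energy G z = 2 * c * (\<Sum>v \<in> pverts G. (z v)\<^sup>2)"
  proof
    fix v assume "v \<in> pverts G"
    then obtain i where i: "i < ?n" "v = ?v i"
      by (metis in_set_conv_nth length_vertex_list vertex_list(2))
    have "laplacian_mat G *\<^sub>v x = c \<cdot>\<^sub>v x" using that eq energy norm by simp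
    then have "(laplacian_mat G *\<^sub>v x) $ i = c * z v" using i x(1) xz by simp
    then show "laplacian G z v = c * z v"
      using laplacian_mat_mult_vec[OF xz x(1) i(1)] i(2) by simp
  qed
  with s z_out le energy norm show thesis by (intro that[of s z]) auto
qed

end

section \<open>Splitting the quadratic form along a vertex set\<close>

lemma sum_square_differences:
  fixes x :: "'a \<Rightarrow> real"
  assumes "finite A" "finite B"
  shows "(\<Sum>a \<in> A. \<Sum>b \<in> B. (x a - x b)\<^sup>2) =
    real (card B) * (\<Sum>a \<in> A. (x a)\<^sup>2) + real (card A) * (\<Sum>b \<in> B. (x b)\<^sup>2) - 2 * sum x A * sum x B"
proof -
  have "(\<Sum>a \<in> A. \<Sum>b \<in> B. (x a - x b)\<^sup>2) =
      (\<Sum>a \<in> A. \<Sum>b \<in> B. (x a)\<^sup>2 + (x b)\<^sup>2 - 2 * (x a * x b))"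
    by (simp add: power2_diff mult.assoc)
  also have "\<dots> = real (card B) * (\<Sum>a \<in> A. (x a)\<^sup>2) + real (card A) * (\<Sum>b \<in> B. (x b)\<^sup>2)
      - 2 * (\<Sum>a \<in> A. \<Sum>b \<in> B. x a * x b)"
    by (simp add: sum_subtractf sum.distrib sum_distrib_left)
  also have "(\<Sum>a \<in> A. \<Sum>b \<in> B. x a * x b) = sum x A * sum x B"
    by (simp add: sum_product)
  finally show ?thesis by simp
qed

lemma square_of_sum_le:
  fixes x :: "'a \<Rightarrow> real"
  assumes "finite A"
  shows "(sum x A)\<^sup>2 \<le> real (card A) * (\<Sum>a \<in> A. (x a)\<^sup>2)"
proof -
  have "0 \<le> (\<Sum>a \<in> A. \<Sum>b \<in> A. (x a - x b)\<^sup>2)" by (intro sum_nonneg) auto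
  then show ?thesis unfolding sum_square_differences[OF assms assms] by (simp add: power2_eq_square)
qed

context pair_graph
begin

text \<open>
  The three parts belong to the edges inside \<open>S\<close>, between \<open>S\<close> and its complement, and inside the
  complement. An edge of the middle part is seen only from its end in \<open>S\<close>, hence the factor 2.
\<close>

lemma dirichlet_energy_split:
  assumes S: "S \<subseteq> pverts G"
  shows "dirichlet_energy G z =
    (\<Sum>s \<in> S. \<Sum>u \<in> nbrs G s \<inter> S. (z s - z u)\<^sup>2)
    + 2 * (\<Sum>s \<in> S. \<Sum>v \<in> nbrs G s - S. (z s - z v)\<^sup>2)
    + (\<Sum>v \<in> pverts G - S. \<Sum>u \<in> nbrs G v - S. (z v - z u)\<^sup>2)"
proof -
  let ?g = "\<lambda>u v. (z u - z v)\<^sup>2"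
  have arcs: "parcs G = (SIGMA v : pverts G. nbrs G v)"
    by (auto simp: nbrs_def dest: in_arcsD1)
  have finS: "finite S" using S pair_finite_verts by (rule finite_subset)
  have "dirichlet_energy G z = (\<Sum>v \<in> pverts G. \<Sum>u \<in> nbrs G v. ?g v u)"
    unfolding dirichlet_energy_def arcs by (subst sum.Sigma) (auto simp: pair_finite_verts finite_nbrs)
  also have "\<dots> = (\<Sum>v \<in> pverts G. (\<Sum>u \<in> nbrs G v \<inter> S. ?g v u) + (\<Sum>u \<in> nbrs G v - S. ?g v u))"
    by (intro sum.cong refl sum.Int_Diff finite_nbrs)
  also have "\<dots> = (\<Sum>v \<in> S. (\<Sum>u \<in> nbrs G v \<inter> S. ?g v u) + (\<Sum>u \<in> nbrs G v - S. ?g v u))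
      + (\<Sum>v \<in> pverts G - S. (\<Sum>u \<in> nbrs G v \<inter> S. ?g v u) + (\<Sum>u \<in> nbrs G v - S. ?g v u))"
    using sum.subset_diff[OF S pair_finite_verts] by (simp only: add.commute)
  also have "(\<Sum>v \<in> pverts G - S. (\<Sum>u \<in> nbrs G v \<inter> S. ?g v u) + (\<Sum>u \<in> nbrs G v - S. ?g v u)) =
      (\<Sum>s \<in> S. \<Sum>v \<in> nbrs G s - S. ?g s v) + (\<Sum>v \<in> pverts G - S. \<Sum>u \<in> nbrs G v - S. ?g v u)"
  proof -
    have "(\<Sum>v \<in> pverts G - S. \<Sum>u \<in> nbrs G v \<inter> S. ?g v u) =
        (\<Sum>v \<in> pverts G - S. \<Sum>u \<in> {u. u \<in> S \<and> (v, u) \<in> parcs G}. ?g v u)"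
      by (intro sum.cong) (auto simp: nbrs_def)
    also have "\<dots> = (\<Sum>u \<in> S. \<Sum>v \<in> {v. v \<in> pverts G - S \<and> (v, u) \<in> parcs G}. ?g v u)"
      by (intro sum.swap_restrict finS) (simp add: pair_finite_verts)
    also have "\<dots> = (\<Sum>s \<in> S. \<Sum>v \<in> nbrs G s - S. ?g s v)"
      by (intro sum.cong) (auto simp: nbrs_def arc_swap power2_commute dest: in_arcsD1 in_arcsD2)
    finally show ?thesis by (simp add: sum.distrib)
  qed
  finally show ?thesis by (simp add: sum.distrib)
qed

lemma sum_verts_split:
  assumes S: "S \<subseteq> pverts G"
  shows "(\<Sum>v \<in> pverts G. f v) = (\<Sum>v \<in> S. f v) + (\<Sum>v \<in> pverts G - S. (f v :: real))"
  using sum.subset_diff[OF S pair_finite_verts] by (simp add: add.commute)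

end

section \<open>The vertices of largest degree\<close>

context pair_graph
begin

text \<open>
  Ties in the degree sequence are broken arbitrarily: any \<open>m\<close>-set between the vertices of degree
  above the \<open>m\<close>-th largest degree and those of degree at least that will do.
\<close>

lemma largest_degree_vertices:
  assumes "1 \<le> m" and "m \<le> card (pverts G)"
  obtains S where "S \<subseteq> pverts G" "card S = m"
    and "\<And>s. s \<in> S \<Longrightarrow> graph_degree G m \<le> card (nbrs G s)"
    and "\<And>v. v \<in> pverts G - S \<Longrightarrow> card (nbrs G v) \<le> graph_degree G m"
proof -
  let ?d = "graph_degree G m"
  have count: "card {v \<in> pverts G. P (card (nbrs G v))} =
      size (filter_mset P (image_mset (out_degree G) (mset_set (pverts G))))" for P
    by (simp add: filter_mset_image_mset filter_mset_mset_set pair_finite_verts out_degree_eq_card_nbrs)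
  have size: "m \<le> size (image_mset (out_degree G) (mset_set (pverts G)))"
    using assms by simp
  have "card {v \<in> pverts G. card (nbrs G v) > ?d} \<le> m"
    unfolding count graph_degree_def using kth_largest_bounds(1)[OF assms(1) size] by simp
  moreover have "m \<le> card {v \<in> pverts G. card (nbrs G v) \<ge> ?d}"
    unfolding count graph_degree_def using kth_largest_bounds(2)[OF assms(1) size] by simp
  ultimately obtain S where "{v \<in> pverts G. card (nbrs G v) > ?d} \<subseteq> S"
    and "S \<subseteq> {v \<in> pverts G. card (nbrs G v) \<ge> ?d}" "card S = m"
    using exists_subset_between[of "{v \<in> pverts G. card (nbrs G v) > ?d}" m
        "{v \<in> pverts G. card (nbrs G v) \<ge> ?d}"] pair_finite_verts by force
  then show thesis by (intro that[of S]) (auto simp: not_less[symmetric])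
qed

text \<open>
  Test functions supported on \<open>S\<close>. If every vertex of \<open>S\<close> had a neighbour outside \<open>S\<close>, the
  edges leaving \<open>S\<close> alone would contribute at least the squared norm to the quadratic form, so the
  bound 1 would be attained by an eigenfunction \<open>z\<close>. Equality forces \<open>z\<close> to be constant along edges
  inside \<open>S\<close> and every vertex of its support to have exactly one outer neighbour; by the degree
  condition each nonzero value is then taken on at least \<open>card S - 1\<close> vertices of \<open>S\<close>. The
  eigenvalue equation at an outer neighbour, where \<open>z\<close> vanishes, makes values of both signs occur, so
  \<open>card S = 2\<close>, and this outer neighbour has two neighbours in \<open>S\<close>, more than its degree allows.
\<close>

lemma exists_inner_vertex:
  assumes S: "S \<subseteq> pverts G" "2 \<le> card S"
    and small: "laplacian_eigenvalue G (card S) \<le> 1"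
    and deg_in: "\<And>s. s \<in> S \<Longrightarrow> card S - 1 \<le> card (nbrs G s)"
    and deg_out: "\<And>v. v \<in> pverts G - S \<Longrightarrow> card (nbrs G v) \<le> card S - 1"
  shows "\<exists>t \<in> S. nbrs G t \<subseteq> S"
proof (rule ccontr)
  assume no: "\<not> ?thesis"
  have finS: "finite S" using S(1) pair_finite_verts by (rule finite_subset)
  have "S \<noteq> {}" using S(2) by auto
  obtain s\<^sub>0 z where s0: "s\<^sub>0 \<in> S" "z s\<^sub>0 \<noteq> 0"
    and z_out': "\<And>v. v \<in> pverts G - S \<Longrightarrow> z v = (\<Sum>s \<in> S. 0 * z s)"
    and le: "dirichlet_energy G z \<le> 2 * 1 * (\<Sum>v \<in> pverts G. (z v)\<^sup>2)"
    and eigen: "dirichlet_energy G z = 2 * 1 * (\<Sum>v \<in> pverts G. (z v)\<^sup>2) \<Longrightarrow>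
      \<forall>v \<in> pverts G. laplacian G z v = 1 * z v"
    by (rule laplacian_test_function[OF S(1) \<open>S \<noteq> {}\<close> small,
        where a = "\<lambda>_ _. 0"]) (rule that)
  have z_out: "z v = 0" if "v \<in> pverts G - S" for v using z_out'[OF that] by simp
  have z_nbr: "z v = 0" if "v \<in> nbrs G u - S" for u v
    using that nbrs_subset[of u] by (intro z_out) auto
  define e where "e s = real (card (nbrs G s - S))" for s
  define I where "I s = (\<Sum>u \<in> nbrs G s \<inter> S. (z s - z u)\<^sup>2)" for s
  have e1: "1 \<le> e s" if "s \<in> S" for s
  proof -
    have "nbrs G s - S \<noteq> {}" using no that by auto
    then show ?thesis by (simp add: e_def Suc_le_eq card_gt_0_iff finite_nbrs)
  qed
  have I0: "0 \<le> I s" for s by (simp add: I_def sum_nonneg)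
  have norm: "(\<Sum>v \<in> pverts G. (z v)\<^sup>2) = (\<Sum>s \<in> S. (z s)\<^sup>2)"
    unfolding sum_verts_split[OF S(1)] by (simp add: z_out)
  have cross: "(\<Sum>v \<in> nbrs G s - S. (z s - z v)\<^sup>2) = e s * (z s)\<^sup>2" for s
  proof -
    have "(\<Sum>v \<in> nbrs G s - S. (z s - z v)\<^sup>2) = (\<Sum>v \<in> nbrs G s - S. (z s)\<^sup>2)"
      using z_nbr[of _ s] by (intro sum.cong refl) simp
    then show ?thesis by (simp add: e_def)
  qed
  have "dirichlet_energy G z = (\<Sum>s \<in> S. I s) + 2 * (\<Sum>s \<in> S. e s * (z s)\<^sup>2)"
  proof -
    have "(\<Sum>v \<in> pverts G - S. \<Sum>u \<in> nbrs G v - S. (z v - z u)\<^sup>2) = 0"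
    proof (intro sum.neutral ballI)
      fix v u assume "v \<in> pverts G - S" "u \<in> nbrs G v - S"
      then show "(z v - z u)\<^sup>2 = 0" using z_out[of v] z_nbr[of u v] by simp
    qed
    then show ?thesis unfolding dirichlet_energy_split[OF S(1)] by (simp add: I_def cross)
  qed
  then have energy: "dirichlet_energy G z - 2 * (\<Sum>v \<in> pverts G. (z v)\<^sup>2) =
      (\<Sum>s \<in> S. I s + 2 * ((e s - 1) * (z s)\<^sup>2))"
    unfolding norm by (simp add: sum.distrib sum_subtractf sum_distrib_left algebra_simps)
  have nonneg: "0 \<le> I s + 2 * ((e s - 1) * (z s)\<^sup>2)" if "s \<in> S" for s
    using e1[OF that] I0[of s] by simp
  have total: "(\<Sum>s \<in> S. I s + 2 * ((e s - 1) * (z s)\<^sup>2)) = 0"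
    using le energy sum_nonneg[of S "\<lambda>s. I s + 2 * ((e s - 1) * (z s)\<^sup>2)"] nonneg by fastforce
  then have eig: "laplacian G z v = z v" if "v \<in> pverts G" for v
    using eigen energy that by simp
  have zero: "I s = 0 \<and> (e s - 1) * (z s)\<^sup>2 = 0" if "s \<in> S" for s
  proof -
    have "I s + 2 * ((e s - 1) * (z s)\<^sup>2) = 0"
      using sum_nonneg_eq_0_iff[OF finS, of "\<lambda>s. I s + 2 * ((e s - 1) * (z s)\<^sup>2)"]
        total that nonneg by blast
    moreover have "0 \<le> (e s - 1) * (z s)\<^sup>2" using e1[OF that] by simp
    ultimately show ?thesis using I0[of s] by linarith
  qed
  have level: "card S - 1 \<le> card {u \<in> S. z u = z s}" if s: "s \<in> S" "z s \<noteq> 0" for s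
  proof -
    have "card (nbrs G s - S) = 1" using zero[OF s(1)] s(2) by (simp add: e_def)
    moreover have "card (nbrs G s) = card (nbrs G s \<inter> S) + card (nbrs G s - S)"
      by (rule card_Int_Diff[OF finite_nbrs])
    moreover have "card (insert s (nbrs G s \<inter> S)) = Suc (card (nbrs G s \<inter> S))"
      by (simp add: finite_nbrs not_nbr_self)
    moreover have "insert s (nbrs G s \<inter> S) \<subseteq> {u \<in> S. z u = z s}"
      using zero[OF s(1)] s(1) by (auto simp: I_def sum_nonneg_eq_0_iff finite_nbrs)
    then have "card (insert s (nbrs G s \<inter> S)) \<le> card {u \<in> S. z u = z s}"
      using finS by (intro card_mono) auto
    ultimately show ?thesis using deg_in[OF s(1)] by simp
  qed
  obtain v where v: "v \<in> nbrs G s\<^sub>0" "v \<notin> S" using no s0(1) by blast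
  then have vV: "v \<in> pverts G - S" and s0v: "s\<^sub>0 \<in> nbrs G v"
    using nbrs_subset by (auto simp: nbrs_def arc_swap)
  have sum0: "(\<Sum>u \<in> nbrs G v. z u) = 0"
    using eig[of v] vV z_out[OF vV] by (simp add: laplacian_eq)
  have "\<exists>s\<^sub>1 \<in> nbrs G v. z s\<^sub>1 * z s\<^sub>0 < 0"
  proof (rule ccontr)
    assume "\<not> ?thesis"
    then have "0 < (\<Sum>u \<in> nbrs G v. z u * z s\<^sub>0)"
      using s0 s0v by (intro sum_pos2[OF finite_nbrs s0v]) (auto simp: not_less mult_neg_neg zero_less_mult_iff)
    then show False by (simp add: sum_distrib_right[symmetric] sum0)
  qed
  then obtain s\<^sub>1 where s1: "s\<^sub>1 \<in> nbrs G v" "z s\<^sub>1 * z s\<^sub>0 < 0" by blast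
  then have s1S: "s\<^sub>1 \<in> S" using z_out[of s\<^sub>1] nbrs_subset by force
  have ne: "z s\<^sub>1 \<noteq> z s\<^sub>0" "z s\<^sub>1 \<noteq> 0" using s1(2) by (auto simp: mult_less_0_iff)
  have "card {u \<in> S. z u = z s\<^sub>0} + card {u \<in> S. z u = z s\<^sub>1} =
      card ({u \<in> S. z u = z s\<^sub>0} \<union> {u \<in> S. z u = z s\<^sub>1})"
    using finS ne by (intro card_Un_disjoint[symmetric]) auto
  also have "\<dots> \<le> card S" using finS by (intro card_mono) auto
  finally have "card S = 2" using level[OF s0] level[OF s1S ne(2)] S(2) by linarith
  moreover have "card {s\<^sub>0, s\<^sub>1} \<le> card (nbrs G v)"
    using s0v s1(1) by (intro card_mono finite_nbrs) auto
  moreover have "s\<^sub>0 \<noteq> s\<^sub>1" using ne(1) by auto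
  ultimately show False using deg_out[OF vV] by simp
qed

lemma nbrs_of_inner_vertex:
  assumes "finite S" "t \<in> S" "nbrs G t \<subseteq> S" "card S - 1 \<le> card (nbrs G t)"
  shows "nbrs G t = S - {t}"
  using assms not_nbr_self[of t] by (intro card_seteq) auto

text \<open>
  Call the vertices of \<open>S\<close> without outer neighbours inner (\<open>T\<close>) and the others boundary vertices
  (\<open>R\<close>). By the degree condition an inner vertex is adjacent to all of \<open>S\<close>. Choose one outer neighbour
  for each boundary vertex, and let \<open>P\<close> be the set of these. The test functions take the value
  \<open>- \<sigma>\<close> on \<open>P\<close>, where \<open>\<sigma>\<close> is the sum of the values on \<open>T\<close>, and 0 elsewhere outside \<open>S\<close>. This
  value is chosen so that in the quadratic form the mixed term \<open>- 2 * \<sigma> * sum z R\<close> from the edges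
  between \<open>T\<close> and \<open>R\<close> cancels against the one from the chosen edges between \<open>R\<close> and \<open>P\<close>. What
  remains exceeds the squared norm by at least \<open>(card R - 1) * qT + card T * qR\<close>, with \<open>qT\<close> and
  \<open>qR\<close> the squared norms on \<open>T\<close> and \<open>R\<close>, which is positive for nonzero values on \<open>S\<close> if \<open>card R\<close> is at least 2.
\<close>

lemma at_most_one_boundary_vertex:
  assumes S: "S \<subseteq> pverts G"
    and small: "laplacian_eigenvalue G (card S) \<le> 1"
    and deg_in: "\<And>s. s \<in> S \<Longrightarrow> card S - 1 \<le> card (nbrs G s)"
    and ex: "\<exists>t \<in> S. nbrs G t \<subseteq> S"
  shows "card {r \<in> S. \<not> nbrs G r \<subseteq> S} \<le> 1"
proof (rule ccontr)
  define T where "T = {t \<in> S. nbrs G t \<subseteq> S}"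
  define R where "R = {r \<in> S. \<not> nbrs G r \<subseteq> S}"
  assume "\<not> card {r \<in> S. \<not> nbrs G r \<subseteq> S} \<le> 1"
  then have R2: "2 \<le> card R" by (simp add: R_def)
  have finS: "finite S" using S pair_finite_verts by (rule finite_subset)
  then have fin: "finite T" "finite R" by (auto simp: T_def R_def)
  have TR: "S = T \<union> R" "T \<inter> R = {}" by (auto simp: T_def R_def)
  have T1: "1 \<le> card T" using ex fin(1) by (auto simp: T_def Suc_le_eq card_gt_0_iff)
  have nbrs_T: "nbrs G t = S - {t}" if "t \<in> T" for t
    using that by (intro nbrs_of_inner_vertex finS deg_in) (auto simp: T_def)
  have "\<forall>r \<in> R. \<exists>v. v \<in> nbrs G r - S" by (auto simp: R_def)
  then obtain f where f: "\<And>r. r \<in> R \<Longrightarrow> f r \<in> nbrs G r - S" by metis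
  define P where "P = f ` R"
  have P: "P \<subseteq> pverts G - S" using f nbrs_subset by (auto simp: P_def)
  have cardP: "real (card P) \<le> real (card R)" using fin(2) by (simp add: P_def card_image_le)
  have "S \<noteq> {}" using ex by auto
  obtain s\<^sub>0 z where s0: "s\<^sub>0 \<in> S" "z s\<^sub>0 \<noteq> 0"
    and z_out': "\<And>v. v \<in> pverts G - S \<Longrightarrow> z v = (\<Sum>s \<in> S. (if v \<in> P \<and> s \<in> T then - 1 else 0) * z s)"
    and le: "dirichlet_energy G z \<le> 2 * 1 * (\<Sum>v \<in> pverts G. (z v)\<^sup>2)"
    by (rule laplacian_test_function[OF S \<open>S \<noteq> {}\<close> small,
        where a = "\<lambda>v s. if v \<in> P \<and> s \<in> T then - 1 else 0"]) (rule that)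
  define \<sigma> where "\<sigma> = sum z T"
  define qT where "qT = (\<Sum>t \<in> T. (z t)\<^sup>2)"
  define qR where "qR = (\<Sum>r \<in> R. (z r)\<^sup>2)"
  have z_out: "z v = (if v \<in> P then - \<sigma> else 0)" if "v \<in> pverts G - S" for v
  proof -
    have "(\<Sum>s \<in> S. (if v \<in> P \<and> s \<in> T then - 1 else 0) * z s) =
        (\<Sum>s \<in> S. if s \<in> T then (if v \<in> P then - z s else 0) else 0)"
      by (intro sum.cong) auto
    also have "\<dots> = (\<Sum>s \<in> S \<inter> T. if v \<in> P then - z s else 0)"
      by (rule sum.inter_restrict[OF finS, symmetric])
    also have "S \<inter> T = T" by (auto simp: TR)
    finally show ?thesis using z_out'[OF that] by (simp add: \<sigma>_def sum_negf)
  qed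
  have norm: "(\<Sum>v \<in> pverts G. (z v)\<^sup>2) = qT + qR + real (card P) * \<sigma>\<^sup>2"
  proof -
    have "(\<Sum>v \<in> pverts G - S. (z v)\<^sup>2) = (\<Sum>v \<in> pverts G - S. if v \<in> P then \<sigma>\<^sup>2 else 0)"
      by (intro sum.cong) (auto simp: z_out)
    also have "\<dots> = (\<Sum>v \<in> (pverts G - S) \<inter> P. \<sigma>\<^sup>2)"
      by (rule sum.inter_restrict[symmetric]) (simp add: pair_finite_verts)
    also have "(pverts G - S) \<inter> P = P" using P by auto
    finally have "(\<Sum>v \<in> pverts G - S. (z v)\<^sup>2) = real (card P) * \<sigma>\<^sup>2" by simp
    moreover have "(\<Sum>s \<in> S. (z s)\<^sup>2) = qT + qR"
      unfolding qT_def qR_def TR(1) by (rule sum.union_disjoint) (use fin TR in auto)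
    ultimately show ?thesis unfolding sum_verts_split[OF S] by simp
  qed
  let ?I = "\<lambda>s. \<Sum>u \<in> nbrs G s \<inter> S. (z s - z u)\<^sup>2"
  have "(\<Sum>t \<in> T. ?I t) = (\<Sum>t \<in> T. \<Sum>s \<in> T. (z t - z s)\<^sup>2) + (\<Sum>t \<in> T. \<Sum>r \<in> R. (z t - z r)\<^sup>2)"
  proof -
    have "?I t = (\<Sum>s \<in> T. (z t - z s)\<^sup>2) + (\<Sum>r \<in> R. (z t - z r)\<^sup>2)" if "t \<in> T" for t
    proof -
      have "?I t = (\<Sum>s \<in> S. (z t - z s)\<^sup>2)"
        using finS by (intro sum.mono_neutral_left) (auto simp: nbrs_T[OF that])
      also have "\<dots> = (\<Sum>s \<in> T. (z t - z s)\<^sup>2) + (\<Sum>r \<in> R. (z t - z r)\<^sup>2)"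
        unfolding TR(1) by (rule sum.union_disjoint) (use fin TR in auto)
      finally show ?thesis .
    qed
    then show ?thesis by (simp add: sum.distrib)
  qed
  moreover have "(\<Sum>r \<in> R. \<Sum>t \<in> T. (z r - z t)\<^sup>2) \<le> (\<Sum>r \<in> R. ?I r)"
  proof (intro sum_mono sum_mono2)
    fix r assume r: "r \<in> R"
    show "T \<subseteq> nbrs G r \<inter> S"
    proof
      fix t assume t: "t \<in> T"
      then have "r \<in> nbrs G t" using r TR nbrs_T[OF t] by auto
      then show "t \<in> nbrs G r \<inter> S" using t TR by (auto simp: nbrs_def arc_swap)
    qed
  qed (auto simp: finite_nbrs)
  moreover have "(\<Sum>s \<in> S. ?I s) = (\<Sum>t \<in> T. ?I t) + (\<Sum>r \<in> R. ?I r)"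
    by (subst TR(1), rule sum.union_disjoint) (use fin TR in auto)
  moreover have "(\<Sum>r \<in> R. (z r + \<sigma>)\<^sup>2) \<le> (\<Sum>s \<in> S. \<Sum>v \<in> nbrs G s - S. (z s - z v)\<^sup>2)"
  proof -
    have "(\<Sum>r \<in> R. (z r + \<sigma>)\<^sup>2) \<le> (\<Sum>r \<in> R. \<Sum>v \<in> nbrs G r - S. (z r - z v)\<^sup>2)"
    proof (intro sum_mono)
      fix r assume r: "r \<in> R"
      have "f r \<in> pverts G - S" "f r \<in> P" using f[OF r] r P by (auto simp: P_def)
      then have "(z r + \<sigma>)\<^sup>2 = (z r - z (f r))\<^sup>2" by (simp add: z_out)
      also have "\<dots> \<le> (\<Sum>v \<in> nbrs G r - S. (z r - z v)\<^sup>2)"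
        using f[OF r] by (intro member_le_sum) (auto simp: finite_nbrs)
      finally show "(z r + \<sigma>)\<^sup>2 \<le> (\<Sum>v \<in> nbrs G r - S. (z r - z v)\<^sup>2)" .
    qed
    also have "\<dots> \<le> (\<Sum>s \<in> S. \<Sum>v \<in> nbrs G s - S. (z s - z v)\<^sup>2)"
      using finS TR by (intro sum_mono2) (auto simp: sum_nonneg)
    finally show ?thesis .
  qed
  moreover have "(\<Sum>r \<in> R. (z r + \<sigma>)\<^sup>2) = qR + 2 * \<sigma> * sum z R + real (card R) * \<sigma>\<^sup>2"
  proof -
    have "(\<Sum>r \<in> R. (z r + \<sigma>)\<^sup>2) = (\<Sum>r \<in> R. (z r)\<^sup>2 + 2 * \<sigma> * z r + \<sigma>\<^sup>2)"
      by (intro sum.cong) (auto simp: power2_sum)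
    then show ?thesis by (simp add: sum.distrib qR_def flip: sum_distrib_left)
  qed
  moreover have "0 \<le> (\<Sum>v \<in> pverts G - S. \<Sum>u \<in> nbrs G v - S. (z v - z u)\<^sup>2)"
    by (simp add: sum_nonneg)
  ultimately have "2 * (real (card T) * qT - \<sigma>\<^sup>2 + real (card R) * qT + real (card T) * qR
      + qR + real (card R) * \<sigma>\<^sup>2) \<le> dirichlet_energy G z"
    unfolding dirichlet_energy_split[OF S] sum_square_differences[OF fin(1) fin(1)]
      sum_square_differences[OF fin(1) fin(2)] sum_square_differences[OF fin(2) fin(1)]
      qT_def[symmetric] qR_def[symmetric] \<sigma>_def[symmetric]
    by (simp add: power2_eq_square algebra_simps)
  moreover have "real (card P) * \<sigma>\<^sup>2 \<le> real (card R) * \<sigma>\<^sup>2"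
    using cardP by (intro mult_right_mono) auto
  moreover have "\<sigma>\<^sup>2 \<le> real (card T) * qT"
    unfolding \<sigma>_def qT_def by (rule square_of_sum_le[OF fin(1)])
  ultimately have "(real (card R) - 1) * qT + real (card T) * qR \<le> 0"
    using le norm by (simp add: algebra_simps)
  moreover have nonneg: "0 \<le> qT" "0 \<le> qR" by (auto simp: qT_def qR_def sum_nonneg)
  moreover have "1 * qT \<le> (real (card R) - 1) * qT" "1 * qR \<le> real (card T) * qR"
    using R2 T1 by (intro mult_right_mono nonneg; simp)+
  ultimately have "qT = 0" "qR = 0" by auto
  then have "z s = 0" if "s \<in> S" for s
    using that fin by (auto simp: TR(1) qT_def qR_def sum_nonneg_eq_0_iff)
  then show False using s0 by blast
qed

text \<open>
  For an edge between \<open>u\<close> and \<open>v\<close> outside the clique, the test functions take the values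
  \<open>- \<sigma>\<close> and \<open>\<sigma>\<close> at \<open>u\<close> and \<open>v\<close>, where \<open>\<sigma>\<close> is the sum of the values on the clique. The clique
  contributes \<open>card S * q - \<sigma>\<^sup>2\<close> to the quadratic form, with \<open>q\<close> the squared norm on \<open>S\<close>. The deficit
  \<open>\<sigma>\<^sup>2\<close>, which is what constant functions on the clique suffer from, is made up for by the edge: it
  contributes \<open>4 * \<sigma>\<^sup>2\<close> at the cost of only \<open>2 * \<sigma>\<^sup>2\<close> in the squared norm.
\<close>

lemma no_arcs_outside_clique:
  assumes S: "S \<subseteq> pverts G" "2 \<le> card S"
    and small: "laplacian_eigenvalue G (card S) \<le> 1"
    and clique: "\<And>s. s \<in> S \<Longrightarrow> S - {s} \<subseteq> nbrs G s"
    and v: "v \<in> pverts G - S"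
  shows "nbrs G v \<subseteq> S"
proof (rule ccontr)
  assume "\<not> nbrs G v \<subseteq> S"
  then obtain u where u: "u \<in> nbrs G v" "u \<notin> S" by blast
  have uv: "u \<in> pverts G - S" "v \<in> nbrs G u" "u \<noteq> v"
    using u subsetD[OF nbrs_subset u(1)] not_nbr_self[of v] by (auto simp: nbrs_def arc_swap)
  have finS: "finite S" using S(1) pair_finite_verts by (rule finite_subset)
  have "S \<noteq> {}" using S(2) by auto
  obtain s\<^sub>0 z where s0: "s\<^sub>0 \<in> S" "z s\<^sub>0 \<noteq> 0"
    and z_out': "\<And>w. w \<in> pverts G - S \<Longrightarrow>
      z w = (\<Sum>s \<in> S. (if w = v then 1 else if w = u then - 1 else 0) * z s)"
    and le: "dirichlet_energy G z \<le> 2 * 1 * (\<Sum>v \<in> pverts G. (z v)\<^sup>2)"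
    by (rule laplacian_test_function[OF S(1) \<open>S \<noteq> {}\<close> small,
        where a = "\<lambda>w _. if w = v then 1 else if w = u then - 1 else 0"]) (rule that)
  define \<sigma> where "\<sigma> = sum z S"
  define q where "q = (\<Sum>s \<in> S. (z s)\<^sup>2)"
  have zv: "z v = \<sigma>" and zu: "z u = - \<sigma>"
    and z_rest: "\<And>w. w \<in> pverts G - S - {u, v} \<Longrightarrow> z w = 0"
    using z_out'[OF v] z_out'[OF uv(1)] z_out' uv(3) by (auto simp: \<sigma>_def sum_negf)
  have "(\<Sum>w \<in> pverts G - S. (z w)\<^sup>2) = (\<Sum>w \<in> {u, v}. (z w)\<^sup>2)"
    using uv v z_rest by (intro sum.mono_neutral_right) (auto simp: pair_finite_verts)
  then have norm: "(\<Sum>w \<in> pverts G. (z w)\<^sup>2) = q + 2 * \<sigma>\<^sup>2"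
    unfolding sum_verts_split[OF S(1)] using uv(3) by (simp add: q_def zv zu)
  have "(\<Sum>s \<in> S. \<Sum>w \<in> nbrs G s \<inter> S. (z s - z w)\<^sup>2) = (\<Sum>s \<in> S. \<Sum>w \<in> S. (z s - z w)\<^sup>2)"
  proof (rule sum.cong[OF refl])
    fix s assume "s \<in> S"
    then show "(\<Sum>w \<in> nbrs G s \<inter> S. (z s - z w)\<^sup>2) = (\<Sum>w \<in> S. (z s - z w)\<^sup>2)"
      using clique[of s] finS by (intro sum.mono_neutral_left) auto
  qed
  moreover have "0 \<le> (\<Sum>s \<in> S. \<Sum>w \<in> nbrs G s - S. (z s - z w)\<^sup>2)"
    by (simp add: sum_nonneg)
  moreover have "2 * (2 * \<sigma>)\<^sup>2 \<le> (\<Sum>w \<in> pverts G - S. \<Sum>x \<in> nbrs G w - S. (z w - z x)\<^sup>2)"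
  proof -
    have "(2 * \<sigma>)\<^sup>2 \<le> (\<Sum>x \<in> nbrs G w - S. (z w - z x)\<^sup>2)" if "w \<in> {u, v}" for w
    proof -
      have "\<exists>x \<in> nbrs G w - S. (z w - z x)\<^sup>2 = (2 * \<sigma>)\<^sup>2"
      proof (cases "w = u")
        case True
        then show ?thesis using uv v by (intro bexI[of _ v]) (auto simp: zu zv power2_eq_square)
      next
        case False
        then show ?thesis using that u by (intro bexI[of _ u]) (auto simp: zu zv power2_eq_square)
      qed
      then obtain x where x: "x \<in> nbrs G w - S" "(z w - z x)\<^sup>2 = (2 * \<sigma>)\<^sup>2" by blast
      have "(z w - z x)\<^sup>2 \<le> (\<Sum>x \<in> nbrs G w - S. (z w - z x)\<^sup>2)"
        using x(1) by (intro member_le_sum) (auto simp: finite_nbrs)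
      with x(2) show ?thesis by simp
    qed
    then have "(\<Sum>w \<in> {u, v}. (2 * \<sigma>)\<^sup>2) \<le> (\<Sum>w \<in> {u, v}. \<Sum>x \<in> nbrs G w - S. (z w - z x)\<^sup>2)"
      by (rule sum_mono)
    also have "\<dots> \<le> (\<Sum>w \<in> pverts G - S. \<Sum>x \<in> nbrs G w - S. (z w - z x)\<^sup>2)"
      using uv v by (intro sum_mono2) (auto simp: pair_finite_verts sum_nonneg)
    finally show ?thesis using uv(3) by simp
  qed
  ultimately have "2 * (real (card S) * q - \<sigma>\<^sup>2 + (2 * \<sigma>)\<^sup>2) \<le> dirichlet_energy G z"
    unfolding dirichlet_energy_split[OF S(1)] sum_square_differences[OF finS finS]
      q_def[symmetric] \<sigma>_def[symmetric]
    by (simp add: power2_eq_square algebra_simps)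
  then have "(real (card S) - 1) * q + \<sigma>\<^sup>2 \<le> 0"
    using le norm by (simp add: power2_eq_square algebra_simps)
  moreover have "0 \<le> q" by (simp add: q_def sum_nonneg)
  moreover have "1 * q \<le> (real (card S) - 1) * q"
    using S(2) \<open>0 \<le> q\<close> by (intro mult_right_mono) auto
  moreover have "0 \<le> \<sigma>\<^sup>2" by simp
  ultimately have "q = 0" by linarith
  then show False using s0 finS by (auto simp: q_def sum_nonneg_eq_0_iff)
qed

text \<open>
  With at most one boundary vertex, \<open>S\<close> is a clique, because inner vertices are adjacent to all of
  \<open>S\<close>. A vertex outside \<open>S\<close> then has no neighbour outside \<open>S\<close> and no inner neighbour, so it can
  only be attached to the boundary vertex (or to the arbitrary \<open>r\<close> if there is none).
\<close>

theorem largest_degrees_form_clique_with_pendants: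
  assumes S: "S \<subseteq> pverts G" "2 \<le> card S"
    and small: "laplacian_eigenvalue G (card S) \<le> 1"
    and deg_in: "\<And>s. s \<in> S \<Longrightarrow> card S - 1 \<le> card (nbrs G s)"
    and deg_out: "\<And>v. v \<in> pverts G - S \<Longrightarrow> card (nbrs G v) \<le> card S - 1"
  obtains r where "r \<in> S"
    and "\<And>s. s \<in> S \<Longrightarrow> nbrs G s \<inter> S = S - {s}"
    and "\<And>v. v \<in> pverts G - S \<Longrightarrow> nbrs G v \<subseteq> {r}"
proof -
  have finS: "finite S" using S(1) pair_finite_verts by (rule finite_subset)
  have ex: "\<exists>t \<in> S. nbrs G t \<subseteq> S" by (rule exists_inner_vertex[OF S small deg_in deg_out])
  have "card {r \<in> S. \<not> nbrs G r \<subseteq> S} \<le> Suc 0"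
    using at_most_one_boundary_vertex[OF S(1) small deg_in ex] by simp
  then have "\<forall>r \<in> S. \<forall>s \<in> S. \<not> nbrs G r \<subseteq> S \<longrightarrow> \<not> nbrs G s \<subseteq> S \<longrightarrow> r = s"
    using finS by (auto simp: card_le_Suc0_iff_eq)
  then have "\<exists>r \<in> S. \<forall>s \<in> S - {r}. nbrs G s \<subseteq> S"
    using ex by blast
  then obtain r where r: "r \<in> S" and inner: "\<And>s. s \<in> S - {r} \<Longrightarrow> nbrs G s \<subseteq> S" by blast
  have nbrs_inner: "nbrs G s = S - {s}" if "s \<in> S - {r}" for s
    using that inner by (intro nbrs_of_inner_vertex finS deg_in) auto
  have clique: "S - {s} \<subseteq> nbrs G s" if "s \<in> S" for s
  proof (cases "s = r")
    case True
    show ?thesis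
    proof
      fix t assume "t \<in> S - {s}"
      then have "r \<in> nbrs G t" using nbrs_inner[of t] r True by auto
      then show "t \<in> nbrs G s" by (simp add: True nbrs_def arc_swap)
    qed
  next
    case False
    then show ?thesis using nbrs_inner[of s] that by simp
  qed
  show thesis
  proof (rule that[OF r])
    show "nbrs G s \<inter> S = S - {s}" if "s \<in> S" for s
      using clique[OF that] not_nbr_self[of s] by auto
    show "nbrs G v \<subseteq> {r}" if v: "v \<in> pverts G - S" for v
    proof
      fix s assume s: "s \<in> nbrs G v"
      then have "s \<in> S" using no_arcs_outside_clique[OF S small clique v] by blast
      moreover have "v \<in> nbrs G s" using s by (simp add: nbrs_def arc_swap)
      ultimately show "s \<in> {r}" using inner[of s] v by auto
    qed
  qed
qed

text \<open>
  The pendant vertices are the outer neighbours of \<open>r\<close>. Since \<open>S\<close> has at least two vertices, none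
  of its vertices is isolated; a one-vertex clique without pendant vertices would be deleted.
\<close>

lemma delete_isolated_iso_attach_pendants:
  assumes S: "S \<subseteq> pverts G" "2 \<le> card S" and r: "r \<in> S"
    and clique: "\<And>s. s \<in> S \<Longrightarrow> nbrs G s \<inter> S = S - {s}"
    and pendant: "\<And>v. v \<in> pverts G - S \<Longrightarrow> nbrs G v \<subseteq> {r}"
  shows "\<exists>p. \<exists>v \<in> pverts (complete_graph (card S)).
    digraph_iso (delete_isolated G) (with_proj (attach_pendants (complete_graph (card S)) v p))"
proof -
  define P where "P = nbrs G r - S"
  have finS: "finite S" using S(1) pair_finite_verts by (rule finite_subset)
  have finP: "finite P" by (simp add: P_def finite_nbrs)
  have arc_iff: "(u, v) \<in> parcs G \<longleftrightarrow>
      u \<in> S \<and> v \<in> S \<and> u \<noteq> v \<or> u = r \<and> v \<in> P \<or> u \<in> P \<and> v = r" for u v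
  proof -
    have mem: "(u, v) \<in> parcs G \<longleftrightarrow> v \<in> nbrs G u" "(u, v) \<in> parcs G \<longleftrightarrow> u \<in> nbrs G v" for u v
      by (auto simp: nbrs_def arc_swap)
    have out: "x = r \<and> y \<in> P" if "y \<in> nbrs G x" "y \<notin> S" for x y
    proof -
      have "y \<in> pverts G - S" "x \<in> nbrs G y" using that nbrs_subset mem by blast+
      then show ?thesis using pendant[of y] that by (auto simp: P_def)
    qed
    have "v \<in> nbrs G u \<longleftrightarrow> u \<noteq> v" if "u \<in> S" "v \<in> S"
      using clique[OF that(1)] that(2) by blast
    moreover have "r \<in> S" "\<forall>x \<in> P. x \<notin> S \<and> x \<in> nbrs G r" using r by (auto simp: P_def)
    ultimately show ?thesis using out[of v u] out[of u v] mem[of u v] mem[of r] mem[of _ r]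
      by blast
  qed
  obtain s' where s': "s' \<in> S" "s' \<noteq> r"
  proof -
    have "S \<noteq> {r}" using S(2) by auto
    then show thesis using that r by blast
  qed
  have isolated: "pverts G - isolated_vertices G = S \<union> P"
  proof -
    have iso: "out_degree G v = 0 \<longleftrightarrow> nbrs G v = {}" for v
      by (simp add: out_degree_eq_card_nbrs finite_nbrs)
    have "nbrs G v \<noteq> {} \<longleftrightarrow> v \<in> S \<union> P" for v
      using arc_iff[of v] r s' by (auto simp: nbrs_def)
    moreover have "S \<union> P \<subseteq> pverts G" using S(1) nbrs_subset by (auto simp: P_def)
    ultimately show ?thesis unfolding isolated_vertices_def iso by blast
  qed
  obtain h where h: "bij_betw h S {..<card S}"
    using ex_bij_betw_finite_nat[OF finS] by (auto simp: atLeast0LessThan)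
  obtain g where g: "bij_betw g P {..<card P}"
    using ex_bij_betw_finite_nat[OF finP] by (auto simp: atLeast0LessThan)
  define \<phi> where "\<phi> v = (if v \<in> S then Inl (h v) else Inr (g v))" for v
  have \<phi>: "\<phi> ` S = Inl ` {..<card S}" "\<phi> ` P = Inr ` {..<card P}"
  proof -
    have "\<phi> ` S = Inl ` h ` S" "\<phi> ` P = Inr ` g ` P"
      by (auto simp: \<phi>_def P_def image_image)
    then show "\<phi> ` S = Inl ` {..<card S}" "\<phi> ` P = Inr ` {..<card P}"
      using h g by (auto simp: bij_betw_def)
  qed
  have inj: "inj_on \<phi> (S \<union> P)"
    using h g by (auto simp: inj_on_def \<phi>_def P_def bij_betw_def split: if_splits)
  have arcs: "parcs G = {(u, v). u \<in> S \<and> v \<in> S \<and> u \<noteq> v} \<union> {r} \<times> P \<union> P \<times> {r}"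
    by (auto simp: arc_iff)
  let ?D = "delete_isolated G" and ?K = "attach_pendants (complete_graph (card S)) (h r) (card P)"
  let ?f = "\<lparr> iso_verts = \<phi>, iso_arcs = map_prod \<phi> \<phi>, iso_head = snd, iso_tail = fst \<rparr>"
  have D: "verts ?D = S \<union> P" "arcs ?D = parcs G" "tail ?D = fst" "head ?D = snd"
    using r by (auto simp: delete_isolated_def induce_subgraph_def isolated arc_iff)
  have "pre_digraph.digraph_isomorphism ?D ?f"
  proof -
    have "wf_digraph ?D" using r by unfold_locales (auto simp: D arc_iff)
    moreover have "inj_on (map_prod \<phi> \<phi>) (parcs G)"
    proof (rule inj_on_subset)
      show "inj_on (map_prod \<phi> \<phi>) ((S \<union> P) \<times> (S \<union> P))" using inj by (intro map_prod_inj_on)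
      show "parcs G \<subseteq> (S \<union> P) \<times> (S \<union> P)" using r by (auto simp: arc_iff)
    qed
    ultimately show ?thesis using inj by (simp add: pre_digraph.digraph_isomorphism_def D)
  qed
  moreover have "with_proj ?K = app_iso ?f ?D"
  proof -
    have hr: "\<phi> r = Inl (h r)" using r by (simp add: \<phi>_def)
    have "map_prod \<phi> \<phi> ` {(u, v). u \<in> S \<and> v \<in> S \<and> u \<noteq> v} =
        map_prod Inl Inl ` map_prod h h ` {(u, v). u \<in> S \<and> v \<in> S \<and> u \<noteq> v}"
      unfolding image_image by (intro image_cong) (auto simp: \<phi>_def)
    also have "map_prod h h ` {(u, v). u \<in> S \<and> v \<in> S \<and> u \<noteq> v} = parcs (complete_graph (card S))"
      (is "?L = ?R")
    proof
      show "?L \<subseteq> ?R" using h by (auto simp: complete_graph_def bij_betw_def inj_on_def)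
      show "?R \<subseteq> ?L"
      proof
        fix a assume "a \<in> ?R"
        then obtain i j where a: "a = (i, j)" "i < card S" "j < card S" "i \<noteq> j"
          by (auto simp: complete_graph_def)
        then have "i \<in> h ` S" "j \<in> h ` S" using h by (auto simp: bij_betw_def)
        then obtain u v where "u \<in> S" "v \<in> S" "i = h u" "j = h v" by blast
        then show "a \<in> ?L" using a by (intro image_eqI[of _ _ "(u, v)"]) auto
      qed
    qed
    finally have "map_prod \<phi> \<phi> ` {(u, v). u \<in> S \<and> v \<in> S \<and> u \<noteq> v} =
        map_prod Inl Inl ` parcs (complete_graph (card S))" .
    moreover have "map_prod \<phi> \<phi> ` ({r} \<times> P) = {Inl (h r)} \<times> Inr ` {..<card P}"
      by (rule map_prod_surj_on) (auto simp: hr \<phi>(2))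
    moreover have "map_prod \<phi> \<phi> ` (P \<times> {r}) = Inr ` {..<card P} \<times> {Inl (h r)}"
      by (rule map_prod_surj_on) (auto simp: hr \<phi>(2))
    ultimately have "map_prod \<phi> \<phi> ` parcs G = parcs ?K"
      unfolding arcs image_Un by (simp add: attach_pendants_def)
    moreover have "\<phi> ` (S \<union> P) = pverts ?K"
      by (simp add: image_Un \<phi> attach_pendants_def complete_graph_def)
    ultimately show ?thesis by (simp add: app_iso_def with_proj_def D)
  qed
  ultimately have "digraph_iso ?D (with_proj ?K)" unfolding digraph_iso_def by blast
  moreover have "h r \<in> pverts (complete_graph (card S))"
    using h r by (auto simp: complete_graph_def bij_betw_def)
  ultimately show ?thesis by blast
qed

end

theorem theorem2p5:
  fixes \<Gamma> :: "'a pair_pre_digraph" and n m :: nat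
  assumes "pair_graph \<Gamma>"
    and "card (pverts \<Gamma>) = n"
    and "m \<in> {1..n}"
    and "laplacian_eigenvalue \<Gamma> m = real (graph_degree \<Gamma> m) - real m + 2"
    and "real (graph_degree \<Gamma> m) - real m + 2 = 1"
  shows "\<exists>p. \<exists>v \<in> pverts (complete_graph m).
    digraph_iso (delete_isolated \<Gamma>) (with_proj (attach_pendants (complete_graph m) v p))"
proof -
  interpret pair_graph \<Gamma> by fact
  have m: "1 \<le> m" "m \<le> card (pverts \<Gamma>)" using assms(2,3) by auto
  have degree: "graph_degree \<Gamma> m = m - 1" using assms(5) m(1) by linarith
  have eigenvalue: "laplacian_eigenvalue \<Gamma> m = 1" using assms(4,5) by simp
  obtain S where S: "S \<subseteq> pverts \<Gamma>" "card S = m"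
    and deg_in: "\<And>s. s \<in> S \<Longrightarrow> card S - 1 \<le> card (nbrs \<Gamma> s)"
    and deg_out: "\<And>v. v \<in> pverts \<Gamma> - S \<Longrightarrow> card (nbrs \<Gamma> v) \<le> card S - 1"
    using largest_degree_vertices[OF m] degree by metis
  \<comment> \<open>For \<open>m = 1\<close> the graph has no edges, so its largest Laplacian eigenvalue is 0, not 1.\<close>
  have "m \<noteq> 1"
  proof
    assume m1: "m = 1"
    then obtain s where s: "S = {s}" using S(2) by (metis card_1_singletonE)
    have "nbrs \<Gamma> v = {}" if "v \<in> pverts \<Gamma> - S" for v
      using deg_out[OF that] S(2) m1 by (simp add: finite_nbrs)
    then have "u = s \<and> v = s" if "(u, v) \<in> parcs \<Gamma>" for u v
      using that in_arcsD1[OF that] in_arcsD2[OF that] arc_swap[of u v] s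
      by (auto simp: nbrs_def)
    then have "a \<notin> parcs \<Gamma>" for a using no_loops' by (cases a) blast
    then have "parcs \<Gamma> = {}" by blast
    from laplacian_eigenvalue_arcless[OF this m] eigenvalue show False by simp
  qed
  with m(1) S(2) have "2 \<le> card S" by simp
  moreover have "laplacian_eigenvalue \<Gamma> (card S) \<le> 1" using eigenvalue S(2) by simp
  ultimately obtain r where "r \<in> S"
    and "\<And>s. s \<in> S \<Longrightarrow> nbrs \<Gamma> s \<inter> S = S - {s}"
    and "\<And>v. v \<in> pverts \<Gamma> - S \<Longrightarrow> nbrs \<Gamma> v \<subseteq> {r}"
    using largest_degrees_form_clique_with_pendants[OF S(1) _ _ deg_in deg_out] by metis
  from delete_isolated_iso_attach_pendants[OF S(1) \<open>2 \<le> card S\<close> this] show ?thesis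
    unfolding S(2) .
qed

end
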